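(* Let $N$ be a positive integer with $\sigma_\infty(\sigma_\infty(N))=2N$ (an infinitary superperfect number) such that $\omega(\sigma_\infty(N))\le 2$. Then $N=2$ or $N=9$.
   Context: $\omega(m)$ denotes the number of distinct prime factors of $m$. Infinitary divisors: every divisor of $n$ is a $0$-ary divisor; a divisor $d$ of $n$ is a $(k+1)$-ary divisor if $d$ and $n/d$ have no common $k$-ary divisor other than $1$; for a prime $p$, $p^f$ is an infinitary divisor of $p^e$ if it is an $(e-1)$-ary divisor of $p^e$, which holds iff the set of positions of $1$'s in the binary expansion of $f$ is a subset of that of $e$. For $n=\prod_i p_i^{e_i}$, a divisor $\prod_i p_i^{f_i}$ is an infinitary divisor iff each $p_i^{f_i}$ is an infinitary divisor of $p_i^{e_i}$. $\sigma_\infty(n)$ is the sum of infinitary divisors of $n$; explicitly, if $e_i=\sum_j y_{ij}2^j$ with $y_{ij}\in\{0,1\}$, then $\sigma_\infty(n)=\prod_i\prod_{j:\,y_{ij}=1}(1+p_i^{2^j})$. *)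

theory Defs
  imports "HOL-Computational_Algebra.Primes"
begin

definition omega :: "nat \<Rightarrow> nat" where
  "omega m = card (prime_factors m)"

fun kary_divisor :: "nat \<Rightarrow> nat \<Rightarrow> nat \<Rightarrow> bool" where
  "kary_divisor 0 d n \<longleftrightarrow> d dvd n"
| "kary_divisor (Suc k) d n \<longleftrightarrow>
     d dvd n \<and> (\<forall>c. kary_divisor k c d \<and> kary_divisor k c (n div d) \<longrightarrow> c = 1)"

text \<open>
  A prime power \<open>p ^ f\<close> is an infinitary divisor of \<open>p ^ e\<close> (\<open>e \<ge> 1\<close>) if it is an
  \<open>(e - 1)\<close>-ary divisor of it; a divisor of \<open>n\<close> is infinitary if this holds for each of
  its prime power components. All of this is intended for \<open>n > 0\<close> only.
\<close>

definition infinitary_divisor :: "nat \<Rightarrow> nat \<Rightarrow> bool" where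
  "infinitary_divisor d n \<longleftrightarrow> d dvd n \<and>
     (\<forall>p\<in>prime_factors n.
        kary_divisor (multiplicity p n - 1) (p ^ multiplicity p d) (p ^ multiplicity p n))"

definition sigma_inf :: "nat \<Rightarrow> nat" where
  "sigma_inf n = (\<Sum>d | infinitary_divisor d n. d)"

end

theory Submission
  imports Defs "HOL-Library.Nat_Bijection" "HOL-Analysis.Infinite_Products"
    "HOL-Number_Theory.Residues"
begin

text \<open>
  Write \<open>n\<close> as the product of its infinitary components, the powers \<open>r ^ 2 ^ j\<close> with \<open>r\<close> prime and \<open>j\<close> a
  binary digit position of the exponent of \<open>r\<close>; then \<open>sigma_inf n\<close> is the product of \<open>1 + q\<close> over the
  components \<open>q\<close>. For \<open>M = sigma_inf N\<close> the weights, that is the products of \<open>1 + 1 / q\<close>, of \<open>M\<close> and \<open>N\<close>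
  multiply to 2. If \<open>M\<close> is odd, then \<open>N\<close> is a power of 2, and since odd prime factors of \<open>x\<^sup>2 + 1\<close> are
  1 modulo 4, only \<open>N = 2\<close> survives. Otherwise \<open>M = 2 ^ a * p ^ b\<close> and \<open>2 * N\<close> is the product of the
  Fermat numbers \<open>1 + 2 ^ 2 ^ j\<close> and the numbers \<open>1 + p ^ 2 ^ j\<close> over the binary digits of \<open>a\<close> and \<open>b\<close>.
  For odd \<open>a\<close>, the weight identity holds only for \<open>N = 9\<close>; for even \<open>a\<close>, the factor 3/2 is missing and
  the components of \<open>N\<close>, each satisfying \<open>1 + q = 2 ^ s * p ^ t\<close>, are too large for the
  total weight to reach 2, apart from one case that is excluded by divisibility.
\<close>

section \<open>Infinitary divisors and binary digits\<close>

text \<open>Disjoint digit sets mean that \<open>f\<close> and \<open>e - f\<close> add up without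
  carries, so the digits of \<open>e\<close> are the union of theirs. Conversely, deleting the
  digits of \<open>f\<close> from those of \<open>e\<close> encodes \<open>e - f\<close>.\<close>

lemma disjoint_set_decode_iff:
  assumes "f \<le> e"
  shows "set_decode f \<inter> set_decode (e - f) = {} \<longleftrightarrow> set_decode f \<subseteq> set_decode e"
proof
  assume disj: "set_decode f \<inter> set_decode (e - f) = {}"
  have "set_encode (set_decode f \<union> set_decode (e - f))
      = set_encode (set_decode f) + set_encode (set_decode (e - f))"
    unfolding set_encode_def using disj by (intro sum.union_disjoint) auto
  then have "set_encode (set_decode f \<union> set_decode (e - f)) = e"
    using assms by simp
  then have "set_decode e = set_decode f \<union> set_decode (e - f)"
    using set_encode_inverse [of "set_decode f \<union> set_decode (e - f)"] by simp
  then show "set_decode f \<subseteq> set_decode e" by blast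
next
  assume sub: "set_decode f \<subseteq> set_decode e"
  then have "set_encode (set_decode e)
      = set_encode (set_decode e - set_decode f) + set_encode (set_decode f)"
    unfolding set_encode_def by (intro sum.subset_diff) auto
  then have "e - f = set_encode (set_decode e - set_decode f)" by simp
  then have "set_decode (e - f) = set_decode e - set_decode f" by simp
  then show "set_decode f \<inter> set_decode (e - f) = {}" by blast
qed

lemma kary_divisor_imp_dvd: "kary_divisor k d n \<Longrightarrow> d dvd n"
  by (cases k) auto

text \<open>Induction on \<open>k\<close>: a common divisor \<open>p ^ g\<close> of both cofactors
  amounts to digits shared by \<open>f\<close> and \<open>e - f\<close>. The bound
  \<open>e \<le> Suc k\<close>, instead of \<open>k = e - 1\<close>, lets the induction hypothesis
  apply to \<open>f\<close> and to \<open>e - f\<close>.\<close>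

lemma kary_divisor_prime_power_iff:
  fixes p :: nat
  assumes "prime p" and "f \<le> e" and "e \<le> Suc k"
  shows "kary_divisor k (p ^ f) (p ^ e) \<longleftrightarrow> set_decode f \<subseteq> set_decode e"
  using assms(2,3)
proof (induction k arbitrary: e f)
  case 0
  then have "f = 0 \<or> f = e" by auto
  then show ?case using 0 by (auto simp: le_imp_power_dvd)
next
  case (Suc k)
  have p: "p > 1" using assms(1) prime_gt_1_nat by blast
  have quot: "p ^ e div p ^ f = p ^ (e - f)"
    using Suc.prems p by (simp add: power_diff)
  have unfold: "kary_divisor (Suc k) (p ^ f) (p ^ e) \<longleftrightarrow>
      (\<forall>g. kary_divisor k (p ^ g) (p ^ f) \<and> kary_divisor k (p ^ g) (p ^ (e - f)) \<longrightarrow> g = 0)"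
  proof -
    have "(\<forall>c. kary_divisor k c (p ^ f) \<and> kary_divisor k c (p ^ (e - f)) \<longrightarrow> c = 1) \<longleftrightarrow>
      (\<forall>g. kary_divisor k (p ^ g) (p ^ f) \<and> kary_divisor k (p ^ g) (p ^ (e - f)) \<longrightarrow> g = 0)"
      (is "?L \<longleftrightarrow> ?R")
    proof
      assume ?L
      then show ?R using p by (auto simp: power_eq_1_iff)
    next
      assume R: ?R
      show ?L
      proof (intro allI impI)
        fix c assume c: "kary_divisor k c (p ^ f) \<and> kary_divisor k c (p ^ (e - f))"
        then have "c dvd p ^ f" using kary_divisor_imp_dvd by blast
        then obtain g where "c = p ^ g" using assms(1) by (auto simp: divides_primepow_nat)
        with R c show "c = 1" by auto
      qed
    qed
    then show ?thesis using Suc.prems quot by (simp add: le_imp_power_dvd)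
  qed
  \<comment> \<open>For \<open>f = 0\<close> or \<open>f = e\<close> one of the exponents
    \<open>f\<close> and \<open>e - f\<close> is \<open>e\<close> itself, which may be out of reach
    of the induction hypothesis.\<close>
  show ?case
  proof (cases "f = 0 \<or> f = e")
    case True
    have "g = 0" if "kary_divisor k (p ^ g) (p ^ 0)" for g
      using kary_divisor_imp_dvd [OF that] p by (cases g) auto
    with True show ?thesis unfolding unfold by auto
  next
    case False
    have iff: "kary_divisor k (p ^ g) (p ^ h) \<longleftrightarrow> set_decode g \<subseteq> set_decode h" if "h \<le> Suc k" for g h
    proof (cases "g \<le> h")
      case True
      then show ?thesis using Suc.IH that by blast
    next
      case False
      then show ?thesis
        using kary_divisor_imp_dvd p subset_decode_imp_le by (meson power_dvd_imp_le)
    qed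
    have "kary_divisor (Suc k) (p ^ f) (p ^ e) \<longleftrightarrow>
        (\<forall>g. set_decode g \<subseteq> set_decode f \<inter> set_decode (e - f) \<longrightarrow> g = 0)"
      unfolding unfold using False Suc.prems iff [of f] iff [of "e - f"] by auto
    \<comment> \<open>If the digit sets meet, the number with exactly the common digits is a nonzero
      \<open>g\<close>.\<close>
    also have "\<dots> \<longleftrightarrow> set_decode f \<inter> set_decode (e - f) = {}"
      by (metis finite_Int finite_set_decode order_refl set_decode_inverse set_decode_zero
          set_encode_inverse subset_empty)
    also have "\<dots> \<longleftrightarrow> set_decode f \<subseteq> set_decode e"
      using Suc.prems(1) by (rule disjoint_set_decode_iff)
    finally show ?thesis .
  qed
qed

text \<open>
  \<open>set_decode e\<close> is the set of positions of the ones in the binary expansion of \<open>e\<close>. Every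
  \<open>n > 0\<close> is the product of its infinitary components, and its infinitary divisors are exactly the
  products of subsets of them.
\<close>

definition infinitary_components :: "nat \<Rightarrow> nat set" where
  "infinitary_components n = {r ^ 2 ^ j | r j. prime r \<and> j \<in> set_decode (multiplicity r n)}"

lemma prime_power_two_power_eq_iff:
  fixes p q :: nat
  assumes "prime p" "prime q"
  shows "p ^ 2 ^ i = q ^ 2 ^ j \<longleftrightarrow> p = q \<and> i = j"
proof
  assume eq: "p ^ 2 ^ i = q ^ 2 ^ j"
  then have "p dvd q ^ 2 ^ j" by (metis dvd_power zero_less_power zero_less_numeral)
  then have "p = q" using assms by (metis prime_dvd_power primes_dvd_imp_eq)
  moreover have "(2::nat) ^ i = 2 ^ j"
    using eq assms(2) \<open>p = q\<close> prime_gt_1_nat by (simp add: power_inject_exp)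
  ultimately show "p = q \<and> i = j" by simp
qed auto

lemma prime_power_in_components_iff:
  "prime r \<Longrightarrow> r ^ 2 ^ j \<in> infinitary_components n \<longleftrightarrow> j \<in> set_decode (multiplicity r n)"
  unfolding infinitary_components_def by (auto simp: prime_power_two_power_eq_iff)

lemma componentE:
  assumes "q \<in> infinitary_components n"
  obtains r j where "prime r" "q = r ^ 2 ^ j" "j \<in> set_decode (multiplicity r n)"
  using assms unfolding infinitary_components_def by blast

lemma finite_components [simp]: "finite (infinitary_components n)"
proof -
  have "infinitary_components n \<subseteq>
      (\<lambda>(r, j). r ^ 2 ^ j) ` (Sigma (prime_factors n) (\<lambda>r. set_decode (multiplicity r n)))"
  proof
    fix q assume "q \<in> infinitary_components n"
    then obtain r j where rj: "prime r" "q = r ^ 2 ^ j" "j \<in> set_decode (multiplicity r n)"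
      by (rule componentE)
    then have "multiplicity r n \<noteq> 0" by (metis empty_iff set_decode_zero)
    then have "r \<in> prime_factors n" using rj by (simp add: prime_factors_multiplicity)
    with rj show "q \<in> (\<lambda>(r, j). r ^ 2 ^ j) ` (Sigma (prime_factors n) (\<lambda>r. set_decode (multiplicity r n)))"
      by force
  qed
  then show ?thesis by (rule finite_subset) auto
qed

lemma component_gt_1:
  assumes "q \<in> infinitary_components n" shows "q > 1"
  using assms by (elim componentE) (simp add: one_less_power [OF prime_gt_1_nat, simplified])

lemma zero_notin_components: "0 \<notin> infinitary_components n"
  using component_gt_1 by fastforce

text \<open>Powers of other primes contribute nothing and \<open>r ^ 2 ^ j\<close> contributes
  \<open>2 ^ j\<close>, so the exponent of \<open>r\<close> is assembled from its binary
  digits.\<close>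

lemma multiplicity_prod_components:
  assumes "S \<subseteq> infinitary_components n" and r: "prime r"
  shows "multiplicity r (\<Prod>S) = set_encode {j. r ^ 2 ^ j \<in> S}"
proof -
  have fin: "finite S" using assms(1) finite_components finite_subset by blast
  have pos: "q \<noteq> 0" if "q \<in> S" for q using component_gt_1 that assms(1) by fastforce
  have inj: "inj_on (\<lambda>j. r ^ 2 ^ j) {j. r ^ 2 ^ j \<in> S}"
    using r by (auto intro!: inj_onI simp: prime_power_two_power_eq_iff)
  have "multiplicity r (\<Prod>S) = (\<Sum>q\<in>S. multiplicity r q)"
  proof (rule prime_elem_multiplicity_prod_distrib)
    show "0 \<notin> (\<lambda>q. q) ` S" using pos by auto
  qed (use r fin in auto)
  also have "\<dots> = (\<Sum>q\<in>(\<lambda>j. r ^ 2 ^ j) ` {j. r ^ 2 ^ j \<in> S}. multiplicity r q)"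
  proof (rule sum.mono_neutral_right)
    show "\<forall>q\<in>S - (\<lambda>j. r ^ 2 ^ j) ` {j. r ^ 2 ^ j \<in> S}. multiplicity r q = 0"
    proof
      fix q assume q: "q \<in> S - (\<lambda>j. r ^ 2 ^ j) ` {j. r ^ 2 ^ j \<in> S}"
      then obtain s j where sj: "prime s" "q = s ^ 2 ^ j"
        using assms(1) by (meson DiffD1 componentE subsetD)
      with q have "s \<noteq> r" by blast
      then show "multiplicity r q = 0"
        using sj r by (simp add: multiplicity_distinct_prime_power)
    qed
  qed (use fin in auto)
  also have "\<dots> = set_encode {j. r ^ 2 ^ j \<in> S}"
    using r inj by (subst sum.reindex) (auto simp: set_encode_def)
  finally show ?thesis .
qed

lemma finite_exponents:
  assumes "S \<subseteq> infinitary_components n" and r: "prime r"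
  shows "finite {j. r ^ 2 ^ j \<in> S}"
proof (rule finite_subset)
  show "{j. r ^ 2 ^ j \<in> S} \<subseteq> set_decode (multiplicity r n)"
    using assms prime_power_in_components_iff by blast
qed simp

lemma prod_components: "n > 0 \<Longrightarrow> \<Prod>(infinitary_components n) = n"
proof (rule multiplicity_eq_nat)
  show "\<Prod>(infinitary_components n) > 0" using component_gt_1 by (intro prod_pos) fastforce
  show "multiplicity r (\<Prod>(infinitary_components n)) = multiplicity r n" if "prime r" for r
    using that by (simp add: multiplicity_prod_components [OF order_refl] prime_power_in_components_iff)
qed

lemma components_prod:
  assumes "S \<subseteq> infinitary_components n"
  shows "infinitary_components (\<Prod>S) = S"
proof -
  have "infinitary_components (\<Prod>S) = {r ^ 2 ^ j | r j. prime r \<and> r ^ 2 ^ j \<in> S}"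
    unfolding infinitary_components_def
    by (simp add: multiplicity_prod_components [OF assms] finite_exponents [OF assms] cong: conj_cong)
  also have "\<dots> = S"
  proof
    show "S \<subseteq> {r ^ 2 ^ j | r j. prime r \<and> r ^ 2 ^ j \<in> S}"
    proof
      fix q assume "q \<in> S"
      moreover then obtain r j where "prime r" "q = r ^ 2 ^ j"
        using assms by (meson componentE subsetD)
      ultimately show "q \<in> {r ^ 2 ^ j | r j. prime r \<and> r ^ 2 ^ j \<in> S}" by blast
    qed
  qed blast
  finally show ?thesis .
qed

lemma infinitary_divisor_iff:
  assumes "n > 0"
  shows "infinitary_divisor d n \<longleftrightarrow> d > 0 \<and> infinitary_components d \<subseteq> infinitary_components n"
proof
  assume inf: "infinitary_divisor d n"
  then have dn: "d dvd n" by (simp add: infinitary_divisor_def)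
  then have d: "d > 0" using assms by (auto intro: Nat.gr0I)
  have "infinitary_components d \<subseteq> infinitary_components n"
  proof
    fix q assume "q \<in> infinitary_components d"
    then obtain r j where rj: "prime r" "q = r ^ 2 ^ j" "j \<in> set_decode (multiplicity r d)"
      by (rule componentE)
    then have "multiplicity r d \<noteq> 0" by (metis empty_iff set_decode_zero)
    moreover have le: "multiplicity r d \<le> multiplicity r n"
      using dn assms by (simp add: dvd_imp_multiplicity_le)
    ultimately have "r \<in> prime_factors n" using rj by (simp add: prime_factors_multiplicity)
    then have "kary_divisor (multiplicity r n - 1) (r ^ multiplicity r d) (r ^ multiplicity r n)"
      using inf by (simp add: infinitary_divisor_def)
    then have "set_decode (multiplicity r d) \<subseteq> set_decode (multiplicity r n)"
      using kary_divisor_prime_power_iff [OF rj(1) le] by simp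
    then show "q \<in> infinitary_components n" using rj by (auto simp: prime_power_in_components_iff)
  qed
  with d show "d > 0 \<and> infinitary_components d \<subseteq> infinitary_components n" by simp
next
  assume d: "d > 0 \<and> infinitary_components d \<subseteq> infinitary_components n"
  have sub: "set_decode (multiplicity r d) \<subseteq> set_decode (multiplicity r n)" if "prime r" for r
    using d that prime_power_in_components_iff by blast
  then have "d dvd n"
    using d by (intro multiplicity_le_imp_dvd) (auto intro: subset_decode_imp_le)
  moreover have "kary_divisor (multiplicity r n - 1) (r ^ multiplicity r d) (r ^ multiplicity r n)"
    if "r \<in> prime_factors n" for r
    using that sub [of r] subset_decode_imp_le
    by (subst kary_divisor_prime_power_iff) (auto simp: in_prime_factors_imp_prime)
  ultimately show "infinitary_divisor d n" by (simp add: infinitary_divisor_def)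
qed

text \<open>Distinct subsets of components have distinct products, so the divisor sum runs over the
  power set and is the expansion of a product of binomials.\<close>

lemma sigma_inf_eq_prod:
  assumes "n > 0"
  shows "sigma_inf n = (\<Prod>q\<in>infinitary_components n. 1 + q)"
proof -
  have "{d. infinitary_divisor d n} = Prod ` Pow (infinitary_components n)"
  proof (intro Set.set_eqI iffI)
    fix d assume "d \<in> {d. infinitary_divisor d n}"
    then have "d > 0" "infinitary_components d \<subseteq> infinitary_components n"
      by (simp_all add: infinitary_divisor_iff [OF assms])
    then show "d \<in> Prod ` Pow (infinitary_components n)"
      using prod_components [of d] by (metis PowI imageI)
  next
    fix d assume "d \<in> Prod ` Pow (infinitary_components n)"
    then obtain S where S: "S \<subseteq> infinitary_components n" "d = \<Prod>S" by blast
    have "d > 0" unfolding S using S(1) component_gt_1 by (intro prod_pos) fastforce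
    then show "d \<in> {d. infinitary_divisor d n}"
      using S by (simp add: infinitary_divisor_iff [OF assms] components_prod)
  qed
  moreover have "inj_on Prod (Pow (infinitary_components n))"
    by (rule inj_on_inverseI [where g = infinitary_components]) (simp add: components_prod)
  ultimately have "sigma_inf n = (\<Sum>S\<in>Pow (infinitary_components n). \<Prod>S)"
    by (simp add: sigma_inf_def sum.reindex)
  also have "\<dots> = (\<Prod>q\<in>infinitary_components n. q + 1)"
    by (subst prod_add) auto
  finally show ?thesis by (simp add: add.commute)
qed

section \<open>Fermat numbers and products of weights\<close>

text \<open>If \<open>r = 4 * m + 3\<close>, raising \<open>x ^ 2 = - 1\<close> modulo
  \<open>r\<close> to the odd power \<open>2 * m + 1 = (r - 1) / 2\<close> contradicts Fermat's
  little theorem.\<close>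

lemma prime_dvd_square_plus_1:
  fixes r x :: nat
  assumes "prime r" "odd r" "r dvd 1 + x\<^sup>2"
  shows "r mod 4 = 1"
proof (rule ccontr)
  assume "r mod 4 \<noteq> 1"
  with \<open>odd r\<close> have "r mod 4 = 3" by presburger
  then obtain m where m: "r = 4 * m + 3" by (metis mult_div_mod_eq)
  have "\<not> r dvd x"
  proof
    assume "r dvd x"
    then have "r dvd x\<^sup>2" by (simp add: dvd_power_iff power2_eq_square)
    with assms(3) have "r dvd 1" by (metis dvd_add_left_iff)
    with assms(1) show False by simp
  qed
  then have "[x ^ (r - 1) = 1] (mod r)" using fermat_theorem assms(1) by blast
  moreover have "r - 1 = 2 * (2 * m + 1)" using m by simp
  ultimately have "[(x\<^sup>2) ^ (2 * m + 1) = 1] (mod r)" by (simp only: power_mult)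
  then have fl: "[(int x ^ 2) ^ (2 * m + 1) = 1] (mod int r)"
    by (metis cong_int_iff of_nat_1 of_nat_power)
  have "int r dvd int (1 + x\<^sup>2)" using assms(3) int_dvd_int_iff by blast
  then have "int r dvd int x ^ 2 - (- 1)" by (simp add: add.commute)
  then have "[int x ^ 2 = - 1] (mod int r)" by (simp add: cong_iff_dvd_diff)
  then have "[(int x ^ 2) ^ (2 * m + 1) = (- 1) ^ (2 * m + 1)] (mod int r)" by (rule cong_pow)
  with fl have "[1 = - 1] (mod int r)" by (simp add: cong_def)
  then have "int r dvd 2" by (simp add: cong_iff_dvd_diff)
  then have "r \<le> 2" by (auto dest: zdvd_imp_le)
  with m show False by simp
qed

lemma power_two_power_eq_square: "(x::'a::monoid_mult) ^ 2 ^ j = (x ^ 2 ^ (j - 1))\<^sup>2" if "j > 0"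
proof -
  have "(2::nat) ^ j = 2 ^ (j - 1) * 2" using that by (metis Suc_diff_1 power_Suc2)
  then show ?thesis by (simp add: power_mult)
qed

lemma prime_dvd_two_power_plus_1:
  fixes r x :: nat
  assumes "prime r" "odd r" "r dvd 1 + x ^ 2 ^ j" "j > 0"
  shows "r mod 4 = 1"
  using assms prime_dvd_square_plus_1 power_two_power_eq_square by metis

lemma odd_square_mod_4: "odd (x::nat) \<Longrightarrow> x\<^sup>2 mod 4 = 1"
proof -
  assume "odd x"
  then obtain k where "x = 2 * k + 1" by (rule oddE)
  then have "x\<^sup>2 = 4 * (k\<^sup>2 + k) + 1" by (simp add: power2_eq_square algebra_simps)
  then show ?thesis by presburger
qed

lemma odd_two_power_mod_4: "odd (x::nat) \<Longrightarrow> j > 0 \<Longrightarrow> x ^ 2 ^ j mod 4 = 1"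
  using odd_square_mod_4 [of "x ^ 2 ^ (j - 1)"] by (simp add: power_two_power_eq_square)

lemma one_mod_4_power: "(x::nat) mod 4 = 1 \<Longrightarrow> x ^ n mod 4 = 1"
  using power_mod [of x 4 n] by simp

text \<open>For \<open>j < k\<close> the number \<open>2 ^ 2 ^ k\<close> is an even power of
  \<open>2 ^ 2 ^ j\<close>, so modulo \<open>r\<close> it is both 1 and -1. That leaves
  \<open>r = 2\<close>, but Fermat numbers are odd.\<close>

lemma fermat_number_common_prime:
  fixes r :: nat
  assumes "prime r" "r dvd 1 + 2 ^ 2 ^ j" "r dvd 1 + 2 ^ 2 ^ k"
  shows "j = k"
proof -
  have minus_1: "[2 ^ n = - 1] (mod int r)" if "r dvd 1 + 2 ^ n" for n
  proof -
    have "int r dvd int (1 + 2 ^ n)" using that int_dvd_int_iff by blast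
    then show ?thesis by (simp add: cong_iff_dvd_diff add.commute)
  qed
  have *: False if "r dvd 1 + 2 ^ 2 ^ j" "r dvd 1 + 2 ^ 2 ^ k" "j < k" for j k
  proof -
    have "[2 ^ 2 ^ j = - 1] (mod int r)"
      using that(1) by (rule minus_1)
    then have "[(2 ^ 2 ^ j) ^ 2 ^ (k - j) = (- 1) ^ 2 ^ (k - j)] (mod int r)" by (rule cong_pow)
    moreover have "((2::int) ^ 2 ^ j) ^ 2 ^ (k - j) = 2 ^ 2 ^ k"
      using that(3) by (simp flip: power_mult power_add)
    moreover have "(- 1 :: int) ^ 2 ^ (k - j) = 1" using that(3) by simp
    ultimately have "[2 ^ 2 ^ k = 1] (mod int r)" by simp
    moreover have "[2 ^ 2 ^ k = - 1] (mod int r)"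
      using that(2) by (rule minus_1)
    ultimately have "[1 = - 1] (mod int r)" by (simp add: cong_def)
    then have "int r dvd 2" by (simp add: cong_iff_dvd_diff)
    then have "r dvd 2" by (metis int_dvd_int_iff of_nat_numeral)
    then have "even (1 + 2 ^ 2 ^ j :: nat)" using assms(1) that(1)
      by (metis prime_nat_iff two_is_prime_nat primes_dvd_imp_eq)
    then show False by simp
  qed
  show ?thesis using * [of j k] * [of k j] assms by (metis linorder_neqE_nat)
qed

text \<open>For even \<open>t\<close> the right side is a square, but 3 is not a square and no
  positive square is one less than another. For odd \<open>t\<close> the geometric sum
  \<open>(p ^ t - 1) / (p - 1)\<close> is an odd divisor of a power of 2, hence 1.\<close>

lemma fermat_number_prime_power:
  fixes p :: nat
  assumes "odd p" "p > 1" "1 + 2 ^ 2 ^ i = p ^ t"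
  shows "t = 1"
proof (cases "even t")
  case True
  then obtain u where u: "t = 2 * u" by (rule evenE)
  show ?thesis
  proof (cases "i = 0")
    case True
    then have "(p ^ u)\<^sup>2 = 3" using assms(3) u by (simp add: power_mult mult.commute flip: power_mult)
    moreover have "odd (p ^ u)" using assms(1) by simp
    ultimately show ?thesis using odd_square_mod_4 [of "p ^ u"] by simp
  next
    case False
    define y where "y = (2::nat) ^ 2 ^ (i - 1)"
    have eq: "(p ^ u)\<^sup>2 = 1 + y\<^sup>2" using assms(3) False u
      by (simp add: power_two_power_eq_square [of i] y_def power_mult mult.commute flip: power_mult)
    have "y > 0" by (simp add: y_def)
    have "y < p ^ u" using eq by (metis less_add_one add.commute power_less_imp_less_base zero_le)
    then have "(y + 1)\<^sup>2 \<le> (p ^ u)\<^sup>2" by (intro power_mono) auto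
    with eq \<open>y > 0\<close> show ?thesis by (simp add: power2_eq_square)
  qed
next
  case False
  have "int p ^ t - 1 = (int p - 1) * (\<Sum>k<t. int p ^ k)" by (rule power_diff_1_eq)
  moreover have "int p ^ t - 1 = 2 ^ 2 ^ i"
    using assms(3) by (metis add_diff_cancel_left' of_nat_1 of_nat_add of_nat_numeral of_nat_power)
  ultimately have "int (\<Sum>k<t. p ^ k) dvd int (2 ^ 2 ^ i)" by simp
  then have "(\<Sum>k<t. p ^ k) dvd 2 ^ 2 ^ i" using int_dvd_int_iff by blast
  then obtain m where m: "(\<Sum>k<t. p ^ k) = 2 ^ m"
    by (auto simp: divides_primepow_nat)
  have "odd (\<Sum>k<n. p ^ k) \<longleftrightarrow> odd n" for n using assms(1) by (induction n) auto
  with False m have "(\<Sum>k<t. p ^ k) = 1" by (metis even_power not_gr0 power_0 dvd_refl)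
  moreover have "(\<Sum>k<2. p ^ k) \<le> (\<Sum>k<t. p ^ k)" if "t \<ge> 2"
    using that by (intro sum_mono2) auto
  moreover have "(\<Sum>k<2. p ^ k) = 1 + p" by (simp add: numeral_2_eq_2)
  moreover have "t \<noteq> 0" using False by (metis even_zero)
  ultimately show ?thesis using assms(2) by (cases "t \<ge> 2") auto
qed

text \<open>The product over a full interval of indices telescopes after multiplication by
  \<open>1 - x ^ 2 ^ k\<close>.\<close>

lemma prod_one_plus_two_power_less:
  fixes x :: real
  assumes "finite A" "A \<subseteq> {k..}" "0 < x" "x < 1"
  shows "(\<Prod>j\<in>A. 1 + x ^ 2 ^ j) < 1 / (1 - x ^ 2 ^ k)"
proof -
  obtain m where m: "A \<subseteq> {..<m}" using assms(1) finite_nat_iff_bounded by blast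
  then have sub: "A \<subseteq> {k..<k + m}" using assms(2) by (auto dest!: subsetD)
  have tele: "(\<Prod>j\<in>{k..<k + m}. 1 + x ^ 2 ^ j) * (1 - x ^ 2 ^ k) = 1 - x ^ 2 ^ (k + m)" for m
  proof (induction m)
    case (Suc m)
    have "x ^ 2 ^ (k + Suc m) = (x ^ 2 ^ (k + m))\<^sup>2" using power_two_power_eq_square [of "k + Suc m" x] by simp
    then have "1 - x ^ 2 ^ (k + Suc m) = (1 + x ^ 2 ^ (k + m)) * (1 - x ^ 2 ^ (k + m))"
      by (simp add: power2_eq_square algebra_simps)
    then show ?case using Suc by (simp add: mult.assoc mult.left_commute)
  qed simp
  have pos: "0 < 1 - x ^ 2 ^ k" using assms by (simp add: power_less_one_iff)
  have "(\<Prod>j\<in>A. 1 + x ^ 2 ^ j) \<le> (\<Prod>j\<in>{k..<k + m}. 1 + x ^ 2 ^ j)"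
    using sub assms(3) by (intro prod_mono2) (auto intro: add_nonneg_nonneg)
  also have "\<dots> = (1 - x ^ 2 ^ (k + m)) / (1 - x ^ 2 ^ k)"
    using tele [of m] pos by (simp add: field_simps)
  also have "\<dots> < 1 / (1 - x ^ 2 ^ k)"
    using pos assms(3) by (intro divide_strict_right_mono) auto
  finally show ?thesis .
qed

section \<open>Weights of sets of components\<close>

text \<open>On the components of \<open>n\<close> this is \<open>sigma_inf n / n\<close>. Arbitrary
  sets are allowed so that parts of the components can be estimated separately.\<close>

definition weight :: "nat set \<Rightarrow> real" where
  "weight S = (\<Prod>q\<in>S. 1 + 1 / real q)"

lemma weight_empty [simp]: "weight {} = 1"
  by (simp add: weight_def)

lemma weight_insert [simp]:
  "finite S \<Longrightarrow> q \<notin> S \<Longrightarrow> weight (insert q S) = (1 + 1 / real q) * weight S"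
  by (simp add: weight_def)

lemma weight_ge_1: "weight S \<ge> 1"
  unfolding weight_def by (rule prod_ge_1) simp

lemma weight_Un_disjoint:
  "finite S \<Longrightarrow> finite T \<Longrightarrow> S \<inter> T = {} \<Longrightarrow> weight (S \<union> T) = weight S * weight T"
  unfolding weight_def by (rule prod.union_disjoint)

lemma weight_mono:
  assumes "finite T" "S \<subseteq> T"
  shows "weight S \<le> weight T"
proof -
  have "weight T = weight S * weight (T - S)"
    using assms weight_Un_disjoint [of S "T - S"] by (simp add: Un_absorb1 finite_subset)
  then show ?thesis using weight_ge_1 [of S] weight_ge_1 [of "T - S"]
    by (simp add: mult_le_cancel_left1)
qed

lemma weight_strict_mono:
  assumes "finite T" "S \<subset> T" "0 \<notin> T"
  shows "weight S < weight T"
proof -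
  obtain q where q: "q \<in> T" "q \<notin> S" using assms(2) by blast
  have fin: "finite S" using assms finite_subset by blast
  have "weight S < (1 + 1 / real q) * weight S"
  proof -
    have "q > 0" using q assms(3) by (metis gr0I)
    then have "0 < 1 / real q * weight S" using weight_ge_1 [of S] by (intro mult_pos_pos) auto
    then show ?thesis by (simp add: algebra_simps)
  qed
  also have "\<dots> = weight (insert q S)" using fin q by simp
  also have "\<dots> \<le> weight T" using assms q by (intro weight_mono) auto
  finally show ?thesis .
qed

lemma weight_infinitary_components:
  assumes "n > 0"
  shows "weight (infinitary_components n) = real (sigma_inf n) / real n"
proof -
  have "1 + 1 / real q = real (1 + q) / real q" if "q \<in> infinitary_components n" for q
    using component_gt_1 [OF that] by (simp add: field_simps)
  then have "weight (infinitary_components n)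
      = (\<Prod>q\<in>infinitary_components n. real (1 + q) / real q)"
    unfolding weight_def by (rule prod.cong [OF refl])
  also have "\<dots> = real (\<Prod>q\<in>infinitary_components n. 1 + q) / real (\<Prod>(infinitary_components n))"
    by (simp only: prod_dividef of_nat_prod)
  finally show ?thesis using assms by (simp add: sigma_inf_eq_prod prod_components)
qed

lemma weight_two_powers_less:
  assumes "prime r" "finite A" "A \<subseteq> {k..}"
  shows "weight ((\<lambda>j. r ^ 2 ^ j) ` A) < 1 / (1 - (1 / real r) ^ 2 ^ k)"
proof -
  have "inj_on (\<lambda>j. r ^ 2 ^ j) A" using assms(1) by (auto intro!: inj_onI simp: prime_power_two_power_eq_iff)
  then have "weight ((\<lambda>j. r ^ 2 ^ j) ` A) = (\<Prod>j\<in>A. 1 + (1 / real r) ^ 2 ^ j)"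
    by (simp add: weight_def prod.reindex power_one_over)
  also have "\<dots> < 1 / (1 - (1 / real r) ^ 2 ^ k)"
    using assms prime_gt_1_nat [of r] by (intro prod_one_plus_two_power_less) auto
  finally show ?thesis .
qed

text \<open>Each factor \<open>1 + 1 / q\<close> is the reciprocal of
  \<open>1 - 1 / (q + 1)\<close>, where \<open>1 / (q + 1)\<close> is half a power of
  \<open>1 / p\<close> and the exponents are distinct. Weierstrass' product inequality reduces the
  bound to a geometric series.\<close>

lemma weight_le_geometric:
  fixes p :: nat
  assumes "finite S" and p: "p \<ge> 3" and "k > 0"
    and S: "\<And>q. q \<in> S \<Longrightarrow> \<exists>t\<ge>k. q + 1 = 2 * p ^ t"
  shows "weight S \<le> 1 / (1 - (1 / real p) ^ k / (2 * (1 - 1 / real p)))"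
proof -
  define x where "x = 1 / real p"
  have x: "0 < x" "x \<le> 1 / 3" using p by (auto simp: x_def field_simps)
  obtain t where t: "\<And>q. q \<in> S \<Longrightarrow> t q \<ge> k \<and> q + 1 = 2 * p ^ t q" using S by metis
  have inj: "inj_on t S" by (rule inj_onI) (metis t add_right_cancel)
  define f where "f q = x ^ t q / 2" for q
  have f01: "f q \<in> {0..1}" for q
    using x power_le_one [of x "t q"] by (simp add: f_def)
  have term_eq: "1 + 1 / real q = 1 / (1 - f q)" if "q \<in> S" for q
  proof -
    have "p ^ t q > 0" using p by simp
    then have "real q + 1 = 2 * real p ^ t q" "q > 0"
      using t [OF that] by (metis of_nat_1 of_nat_add of_nat_mult of_nat_numeral of_nat_power, linarith)
    moreover have "f q = 1 / (2 * real p ^ t q)" by (simp add: f_def x_def power_one_over)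
    ultimately have "f q = 1 / (real q + 1)" by simp
    then have "1 - f q = real q / (real q + 1)" by (simp add: field_simps)
    then have "1 / (1 - f q) = (real q + 1) / real q" by simp
    also have "\<dots> = 1 + 1 / real q" using \<open>q > 0\<close> by (simp add: field_simps)
    finally show ?thesis by simp
  qed
  have sumx: "(\<Sum>q\<in>S. x ^ t q) \<le> x ^ k / (1 - x)"
  proof -
    obtain m where m: "t ` S \<subseteq> {..<m}" using assms(1) finite_nat_iff_bounded by blast
    have "(\<Sum>q\<in>S. x ^ t q) = (\<Sum>n\<in>t ` S. x ^ n)" using inj by (simp add: sum.reindex)
    also have "\<dots> \<le> (\<Sum>n\<in>{k..<k + m}. x ^ n)"
      using m t x by (intro sum_mono2) fastforce+
    also have "\<dots> = (\<Sum>n<m. x ^ (k + n))"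
      by (rule sum.reindex_bij_witness [of _ "\<lambda>n. k + n" "\<lambda>n. n - k"]) auto
    also have "\<dots> = x ^ k * (\<Sum>n<m. x ^ n)" by (simp add: power_add sum_distrib_left)
    also have "\<dots> = x ^ k * ((1 - x ^ m) / (1 - x))" using x by (simp add: sum_gp_strict)
    also have "\<dots> \<le> x ^ k * (1 / (1 - x))"
      using x by (intro mult_left_mono divide_right_mono) auto
    finally show ?thesis by simp
  qed
  \<comment> \<open>The Weierstrass lower bound is thus at least 3/4, so it is positive and may be
    inverted.\<close>
  have "x ^ k / (1 - x) \<le> (1 / 3) / (2 / 3)"
  proof (rule frac_le)
    have "x ^ k \<le> x ^ 1" using x \<open>k > 0\<close> by (intro power_decreasing) auto
    then show "x ^ k \<le> 1 / 3" using x by simp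
  qed (use x in auto)
  then have pos: "0 < 1 - x ^ k / (2 * (1 - x))" using x by (simp add: field_simps)
  have "1 - x ^ k / (2 * (1 - x)) \<le> 1 - sum f S"
    using sumx x by (simp add: f_def sum_divide_distrib [symmetric] field_simps)
  also have "\<dots> \<le> (\<Prod>q\<in>S. 1 - f q)" using f01 by (rule Weierstrass_prod_ineq)
  finally have le: "1 - x ^ k / (2 * (1 - x)) \<le> (\<Prod>q\<in>S. 1 - f q)" .
  have "weight S = (\<Prod>q\<in>S. 1 / (1 - f q))"
    unfolding weight_def using term_eq by (rule prod.cong [OF refl])
  also have "\<dots> = 1 / (\<Prod>q\<in>S. 1 - f q)" by (simp add: prod_dividef)
  also have "\<dots> \<le> 1 / (1 - x ^ k / (2 * (1 - x)))"
    using le pos by (intro divide_left_mono) auto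
  finally show ?thesis by (simp add: x_def)
qed

section \<open>Images with exactly two prime factors\<close>

lemma infinitary_components_two_primes:
  assumes "prime p" "prime q" "p \<noteq> q"
  shows "infinitary_components (p ^ a * q ^ b)
    = (\<lambda>j. p ^ 2 ^ j) ` set_decode a \<union> (\<lambda>j. q ^ 2 ^ j) ` set_decode b"
proof -
  have mult: "multiplicity r (p ^ a * q ^ b) = (if r = p then a else if r = q then b else 0)"
    if "prime r" for r
  proof -
    have "multiplicity r (p ^ a * q ^ b) = multiplicity r (p ^ a) + multiplicity r (q ^ b)"
      using that assms by (intro prime_elem_multiplicity_mult_distrib) auto
    then show ?thesis
      using that assms by (auto simp: multiplicity_distinct_prime_power)
  qed
  have "x \<in> infinitary_components (p ^ a * q ^ b) \<longleftrightarrow>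
      x \<in> (\<lambda>j. p ^ 2 ^ j) ` set_decode a \<union> (\<lambda>j. q ^ 2 ^ j) ` set_decode b" for x
  proof
    assume "x \<in> infinitary_components (p ^ a * q ^ b)"
    then show "x \<in> (\<lambda>j. p ^ 2 ^ j) ` set_decode a \<union> (\<lambda>j. q ^ 2 ^ j) ` set_decode b"
      by (elim componentE) (auto simp: mult split: if_splits)
  next
    assume "x \<in> (\<lambda>j. p ^ 2 ^ j) ` set_decode a \<union> (\<lambda>j. q ^ 2 ^ j) ` set_decode b"
    then show "x \<in> infinitary_components (p ^ a * q ^ b)"
      using assms by (auto simp: prime_power_in_components_iff mult)
  qed
  then show ?thesis by blast
qed

lemma component_dvd: "q \<in> infinitary_components n \<Longrightarrow> n > 0 \<Longrightarrow> q dvd n"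
  using dvd_prodI [of "infinitary_components n" q "\<lambda>q. q"] prod_components by auto

lemma Suc_component_dvd:
  "q \<in> infinitary_components n \<Longrightarrow> n > 0 \<Longrightarrow> 1 + q dvd sigma_inf n"
  using dvd_prodI [of "infinitary_components n" q "\<lambda>q. 1 + q"] sigma_inf_eq_prod by auto

lemma prime_dvd_imp_component:
  assumes "prime r" "r dvd n" "n > 0"
  obtains j where "r ^ 2 ^ j \<in> infinitary_components n"
proof -
  have "multiplicity r n \<noteq> 0" using assms by (simp add: prime_multiplicity_gt_zero_iff)
  then have "set_decode (multiplicity r n) \<noteq> {}"
    by (metis set_decode_inverse set_encode_empty)
  then show ?thesis using that assms(1) prime_power_in_components_iff by blast
qed

lemma two_power_two_power_mod_3: "(2::nat) ^ 2 ^ j mod 3 = 1" if "j > 0"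
proof -
  have "(2::nat) ^ 2 ^ j = 4 ^ 2 ^ (j - 1)"
  proof -
    have "(2::nat) ^ j = 2 * 2 ^ (j - 1)" using that by (metis Suc_diff_1 power_Suc)
    then show ?thesis by (simp add: power_mult)
  qed
  also have "\<dots> mod 3 = (4 mod 3) ^ 2 ^ (j - 1) mod 3" by (simp only: power_mod)
  finally show ?thesis by simp
qed

lemma set_decode_even: "even n \<Longrightarrow> set_decode n \<subseteq> {1..}"
proof
  fix j assume "even n" "j \<in> set_decode n"
  then have "j \<noteq> 0" by (metis set_decode_0)
  then show "j \<in> {1..}" by simp
qed

section \<open>Setup for an image \<open>2 ^ a * p ^ b\<close> with \<open>p\<close> an odd
  prime\<close>

locale superperfect_two_primes =
  fixes N p a b :: nat
  assumes N_pos: "N > 0"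
    and prime_p: "prime p" and odd_p: "odd p"
    and a_pos: "a > 0" and b_pos: "b > 0"
    and sigma_N: "sigma_inf N = 2 ^ a * p ^ b"
    and sigma_M: "sigma_inf (2 ^ a * p ^ b) = 2 * N"
begin

abbreviation "A \<equiv> set_decode a"
abbreviation "B \<equiv> set_decode b"
abbreviation "CN \<equiv> infinitary_components N"
abbreviation "CM \<equiv> infinitary_components (2 ^ a * p ^ b)"

lemma p_ge_3: "p \<ge> 3"
  using prime_p odd_p prime_ge_2_nat [of p] by (cases "p = 2") auto

lemma M_pos: "2 ^ a * p ^ b > 0"
  using p_ge_3 by simp

lemma A_nonempty: "A \<noteq> {}" and B_nonempty: "B \<noteq> {}"
  using a_pos b_pos by (metis less_irrefl set_decode_inverse set_encode_empty)+

lemma CM_eq: "CM = (\<lambda>j. 2 ^ 2 ^ j) ` A \<union> (\<lambda>j. p ^ 2 ^ j) ` B"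
  using odd_p prime_p by (intro infinitary_components_two_primes) auto

lemma CM_disjoint: "(\<lambda>j. 2 ^ 2 ^ j) ` A \<inter> (\<lambda>j. p ^ 2 ^ j) ` B = {}"
  using odd_p prime_p by (auto simp: prime_power_two_power_eq_iff)

lemma weight_CM: "weight CM = weight ((\<lambda>j. 2 ^ 2 ^ j) ` A) * weight ((\<lambda>j. p ^ 2 ^ j) ` B)"
  unfolding CM_eq by (rule weight_Un_disjoint) (use CM_disjoint in auto)

lemma two_N_eq: "2 * N = (\<Prod>j\<in>A. 1 + 2 ^ 2 ^ j) * (\<Prod>j\<in>B. 1 + p ^ 2 ^ j)"
proof -
  have inj: "inj_on (\<lambda>j. r ^ 2 ^ j) X" if "prime r" for r :: nat and X
    using that by (auto intro!: inj_onI simp: prime_power_two_power_eq_iff)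
  have "2 * N = (\<Prod>q\<in>CM. 1 + q)" using sigma_M sigma_inf_eq_prod [OF M_pos] by simp
  also have "\<dots> = (\<Prod>q\<in>(\<lambda>j. 2 ^ 2 ^ j) ` A. 1 + q) * (\<Prod>q\<in>(\<lambda>j. p ^ 2 ^ j) ` B. 1 + q)"
    unfolding CM_eq by (rule prod.union_disjoint) (use CM_disjoint in auto)
  also have "\<dots> = (\<Prod>j\<in>A. 1 + 2 ^ 2 ^ j) * (\<Prod>j\<in>B. 1 + p ^ 2 ^ j)"
    by (simp add: prod.reindex inj prime_p)
  finally show ?thesis .
qed

lemma weight_mult: "weight CM * weight CN = 2"
  using N_pos M_pos p_ge_3 by (simp add: weight_infinitary_components sigma_N sigma_M)

text \<open>Refutes a configuration as soon as a few known components on both sides have weights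
  multiplying beyond 2.\<close>

lemma weight_mult_le:
  assumes "S \<subseteq> CM" "T \<subseteq> CN"
  shows "weight S * weight T \<le> 2"
proof -
  have "weight S * weight T \<le> weight CM * weight CN"
    using assms weight_ge_1 [of S] weight_ge_1 [of T] weight_ge_1 [of CM]
    by (intro mult_mono weight_mono) auto
  then show ?thesis using weight_mult by simp
qed

text \<open>The strict version also refutes configurations of weight exactly 2, given one further
  component of \<open>M\<close>.\<close>

lemma weight_mult_less:
  assumes "S \<subset> CM" "T \<subseteq> CN"
  shows "weight S * weight T < 2"
proof -
  have "weight S < weight CM"
    using assms zero_notin_components by (intro weight_strict_mono) auto
  moreover have "weight T \<le> weight CN" using assms by (intro weight_mono) auto
  ultimately have "weight S * weight T < weight CM * weight CN"
    using weight_ge_1 [of S] weight_ge_1 [of T] by (intro mult_less_le_imp_less) auto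
  then show ?thesis using weight_mult by simp
qed

lemma prime_dvd_two_N_cases:
  assumes "prime r" "r dvd 2 * N"
  obtains j where "j \<in> A" "r dvd 1 + 2 ^ 2 ^ j" | j where "j \<in> B" "r dvd 1 + p ^ 2 ^ j"
proof -
  have "r dvd (\<Prod>j\<in>A. 1 + 2 ^ 2 ^ j) \<or> r dvd (\<Prod>j\<in>B. 1 + p ^ 2 ^ j)"
    using assms unfolding two_N_eq by (simp only: prime_dvd_mult_iff)
  then show ?thesis
    using that assms(1) by (simp only: prime_dvd_prod_iff finite_set_decode) blast
qed

lemma fermat_dvd_N: "j \<in> A \<Longrightarrow> 1 + 2 ^ 2 ^ j dvd N"
proof -
  assume j: "j \<in> A"
  have "1 + 2 ^ 2 ^ j dvd (\<Prod>j\<in>A. 1 + 2 ^ 2 ^ j :: nat)" using j by (intro dvd_prodI) auto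
  then have "1 + 2 ^ 2 ^ j dvd 2 * N" unfolding two_N_eq by (rule dvd_mult2)
  moreover have "coprime (1 + 2 ^ 2 ^ j) (2::nat)" by simp
  ultimately show ?thesis using coprime_dvd_mult_right_iff by blast
qed

lemma p_power_dvd_two_N: "j \<in> B \<Longrightarrow> 1 + p ^ 2 ^ j dvd 2 * N"
proof -
  assume j: "j \<in> B"
  have "1 + p ^ 2 ^ j dvd (\<Prod>j\<in>B. 1 + p ^ 2 ^ j)" using j by (intro dvd_prodI) auto
  then show ?thesis unfolding two_N_eq by (rule dvd_mult)
qed

section \<open>Shape of the components of \<open>N\<close> by residue modulo 4\<close>

lemma component_decomp:
  assumes "q \<in> CN"
  obtains s t where "1 + q = 2 ^ s * p ^ t" "s \<le> a" "t \<le> b"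
proof -
  have "1 + q dvd 2 ^ a * p ^ b" using Suc_component_dvd [OF assms N_pos] sigma_N by simp
  then obtain x y where "1 + q = x * y" "x dvd 2 ^ a" "y dvd p ^ b"
    using division_decomp by blast
  then show ?thesis
    using that prime_p two_is_prime_nat by (metis divides_primepow_nat)
qed

text \<open>Here \<open>1 + q\<close> is 2 modulo 4, so it contains exactly one factor 2;
  \<open>t = 0\<close> would mean \<open>q = 1\<close>.\<close>

lemma component_1_mod_4:
  assumes "q \<in> CN" "q mod 4 = 1"
  obtains t where "t \<ge> 1" "t \<le> b" "q + 1 = 2 * p ^ t"
proof -
  obtain s t where st: "1 + q = 2 ^ s * p ^ t" "s \<le> a" "t \<le> b"
    using component_decomp [OF assms(1)] by blast
  have "s = 1"
  proof -
    have "even (1 + q)" using assms(2) by presburger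
    then have "s \<noteq> 0" using st(1) odd_p by (metis even_power mult_1 power_0)
    moreover have "\<not> 4 dvd 1 + q" using assms(2) by presburger
    then have "\<not> s \<ge> 2" using st(1) by (metis dvd_mult2 le_imp_power_dvd power2_eq_square mult_2 numeral_Bit0)
    ultimately show ?thesis by simp
  qed
  moreover have "t \<noteq> 0"
  proof
    assume "t = 0"
    then show False using \<open>s = 1\<close> st(1) component_gt_1 [OF assms(1)] by simp
  qed
  ultimately show ?thesis using that [of t] st by simp
qed

text \<open>An odd square is 1 modulo 4, so \<open>q\<close> is prime. As \<open>q\<close> divides
  \<open>2 * N\<close> but no square plus 1, it must divide a factor belonging to digit 0, that is 3
  or \<open>1 + p\<close>.\<close>

lemma component_3_mod_4:
  assumes "q \<in> CN" "q mod 4 = 3"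
  shows "prime q" "q = 3 \<and> 0 \<in> A \<or> q dvd 1 + p \<and> 0 \<in> B"
proof -
  obtain r j where rj: "prime r" "q = r ^ 2 ^ j" using assms(1) by (rule componentE)
  have "odd q" using assms(2) by presburger
  then have "odd r" using rj by simp
  then have "j = 0" using odd_two_power_mod_4 [of r j] rj assms(2) by (cases "j = 0") auto
  with rj show "prime q" by simp
  have "q dvd 2 * N" using component_dvd [OF assms(1) N_pos] by simp
  with \<open>prime q\<close> show "q = 3 \<and> 0 \<in> A \<or> q dvd 1 + p \<and> 0 \<in> B"
  proof (cases rule: prime_dvd_two_N_cases)
    case (1 j)
    then have "j = 0"
      using prime_dvd_two_power_plus_1 [of q 2 j] \<open>prime q\<close> \<open>odd q\<close> assms(2) by (cases "j = 0") auto
    then have "q dvd 3" using 1 by (simp add: numeral_3_eq_3)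
    then have "q = 3" using \<open>prime q\<close> primes_dvd_imp_eq [of q 3] by simp
    with 1 \<open>j = 0\<close> show ?thesis by simp
  next
    case (2 j)
    then have "j = 0"
      using prime_dvd_two_power_plus_1 [of q p j] \<open>prime q\<close> \<open>odd q\<close> assms(2) by (cases "j = 0") auto
    with 2 show ?thesis by simp
  qed
qed

text \<open>An even component is a power of 2, and \<open>1 + q\<close> is odd, hence both a Fermat
  number and a power of \<open>p\<close>.\<close>

lemma component_even:
  assumes "q \<in> CN" "even q"
  shows "q + 1 = p"
proof -
  obtain r i where ri: "prime r" "q = r ^ 2 ^ i" using assms(1) by (rule componentE)
  then have "even r" using assms(2) by simp
  then have "r = 2" using ri(1) by (metis primes_dvd_imp_eq two_is_prime_nat)
  obtain s t where st: "1 + q = 2 ^ s * p ^ t" using component_decomp [OF assms(1)] by blast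
  have "odd (1 + q)" using assms(2) by simp
  with st have "s = 0" by (metis dvd_mult2 dvd_power not_gr0)
  then have "1 + 2 ^ 2 ^ i = p ^ t" using st ri \<open>r = 2\<close> by simp
  then have "t = 1" using fermat_number_prime_power odd_p p_ge_3 by force
  then show ?thesis using st \<open>s = 0\<close> by simp
qed

text \<open>A component that is a power of \<open>p\<close> would be 1 modulo 4, and then
  \<open>p\<close> would also divide its successor.\<close>

lemma p_not_dvd_N:
  assumes "p mod 4 = 1"
  shows "\<not> p dvd N"
proof
  assume "p dvd N"
  then obtain k where k: "p ^ 2 ^ k \<in> CN" using prime_dvd_imp_component prime_p N_pos by blast
  have "p ^ 2 ^ k mod 4 = 1" using assms by (rule one_mod_4_power)
  then obtain t where t: "t \<ge> 1" "p ^ 2 ^ k + 1 = 2 * p ^ t"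
    using component_1_mod_4 [OF k] by blast
  then have "p dvd p ^ 2 ^ k + 1" by (simp add: dvd_power)
  moreover have "p dvd p ^ 2 ^ k" by (simp add: dvd_power)
  ultimately have "p dvd 1" by (metis dvd_add_right_iff)
  then show False using p_ge_3 by simp
qed

text \<open>
  The components 2 of \<open>M\<close> and 3 of \<open>N\<close> alone would give weight 2, so the prime 3 enters \<open>N\<close> through a
  higher component, which is \<open>2 p\<^sup>t - 1\<close> and divides \<open>3 (p + 1)\<close>; this leaves only \<open>p = 5\<close>.
\<close>

lemma N_eq_9:
  assumes "odd a"
  shows "N = 9"
proof -
  have A0: "0 \<in> A" using assms by simp
  have two: "2 \<in> CM" unfolding CM_eq using A0 by (intro UnI1 image_eqI [of _ _ 0]) auto
  obtain j0 where "j0 \<in> B" using B_nonempty by blast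
  then have pj: "p ^ 2 ^ j0 \<in> CM" unfolding CM_eq by blast
  have ne2: "p ^ 2 ^ j0 \<noteq> 2" using odd_p by (metis even_power dvd_refl)
  have "3 dvd N" using fermat_dvd_N [OF A0] by (simp add: numeral_3_eq_3)
  then obtain k where k: "3 ^ 2 ^ k \<in> CN" using prime_dvd_imp_component [of 3 N] N_pos by auto
  have "3 \<notin> CN"
  proof
    assume "3 \<in> CN"
    then have "weight {2} * weight {3} < 2"
      using two pj ne2 by (intro weight_mult_less) auto
    then show False by simp
  qed
  with k have "k > 0" by (cases "k = 0") auto
  define q where "q = (3::nat) ^ 2 ^ k"
  have q: "q \<in> CN" "q mod 4 = 1" using k \<open>k > 0\<close> odd_two_power_mod_4 [of 3 k] by (auto simp: q_def)
  have "q \<ge> 3 ^ 2"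
    unfolding q_def using \<open>k > 0\<close> by (intro power_increasing) (auto simp: self_le_power)
  then have q9: "q \<ge> 9" by simp
  have dvd9: "3 ^ 2 dvd q" unfolding q_def using \<open>k > 0\<close> by (intro le_imp_power_dvd) (auto simp: self_le_power)
  obtain t where t: "t \<ge> 1" "q + 1 = 2 * p ^ t" using component_1_mod_4 [OF q] by blast
  have "p \<noteq> 3"
  proof
    assume "p = 3"
    then have "3 dvd q + 1" using t by (simp add: dvd_power)
    moreover have "3 dvd q" using dvd9 by auto
    ultimately show False by presburger
  qed
  \<comment> \<open>These are the factors of \<open>2 * N\<close> belonging to nonzero digits. Each
    is a square plus 1, so 3 divides none of them.\<close>
  define P where "P = (\<Prod>j\<in>A - {0}. 1 + 2 ^ 2 ^ j) * (\<Prod>j\<in>B - {0}. 1 + p ^ 2 ^ j)"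
  have not3: "\<not> 3 dvd 1 + x ^ 2 ^ j" if "j > 0" for x j :: nat
    using prime_dvd_two_power_plus_1 [of 3 x j] that by auto
  have P3: "\<not> 3 dvd P"
    unfolding P_def using not3 by (auto simp: prime_dvd_mult_iff prime_dvd_prod_iff)
  have prodA: "(\<Prod>j\<in>A. 1 + 2 ^ 2 ^ j) = 3 * (\<Prod>j\<in>A - {0}. 1 + 2 ^ 2 ^ j :: nat)"
    using A0 by (subst prod.remove [of A 0]) auto
  have q_dvd: "q dvd 2 * N" using component_dvd [OF q(1) N_pos] by simp
  have B0: "0 \<in> B"
  proof (rule ccontr)
    assume "0 \<notin> B"
    then have "2 * N = 3 * P" unfolding two_N_eq prodA P_def by simp
    with q_dvd dvd9 have "3 * 3 dvd 3 * P" by (metis dvd_trans power2_eq_square)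
    then show False using P3 by simp
  qed
  then have prodB: "(\<Prod>j\<in>B. 1 + p ^ 2 ^ j) = (1 + p) * (\<Prod>j\<in>B - {0}. 1 + p ^ 2 ^ j)"
    by (subst prod.remove [of B 0]) auto
  have "2 * N = 3 * (1 + p) * P" unfolding two_N_eq prodA prodB P_def by (simp only: mult_ac)
  moreover have "coprime q P"
    unfolding q_def using P3 by (simp add: prime_imp_coprime)
  ultimately have "q dvd 3 * (1 + p)" using q_dvd by (metis coprime_dvd_mult_left_iff)
  moreover have "2 dvd 3 * (1 + p)" using odd_p by simp
  moreover have "coprime 2 q" unfolding q_def by simp
  ultimately have "2 * q dvd 3 * (1 + p)" by (simp only: divides_mult)
  then have le: "2 * q \<le> 3 * (1 + p)" by (auto dest: dvd_imp_le)
  \<comment> \<open>Now \<open>4 * p - 2 \<le> 4 * p ^ t - 2 = 2 * q \<le> 3 * (1 + p)\<close> gives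
    \<open>p \<le> 5\<close>.\<close>
  have "p \<le> p ^ t" using t(1) p_ge_3 by (simp add: self_le_power)
  moreover have "2 * q + 2 = 4 * p ^ t" using t(2) by simp
  ultimately have "p \<le> 5" using le by simp
  moreover have "p \<noteq> 4" using odd_p by auto
  ultimately have "p = 5" using p_ge_3 \<open>p \<noteq> 3\<close> by linarith
  with le q9 have "q = 9" by simp
  \<comment> \<open>The components 2 and 5 of \<open>M\<close> and 9 of \<open>N\<close> already
    give 3/2 * 6/5 * 10/9 = 2, so there is no room for another component.\<close>
  have "CN = {9}"
  proof (rule ccontr)
    assume "CN \<noteq> {9}"
    then have "{9} \<subset> CN" using q \<open>q = 9\<close> by auto
    then have "weight {9} < weight CN" using zero_notin_components by (intro weight_strict_mono) auto
    moreover have "weight {2, 5} \<le> weight CM"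
    proof (rule weight_mono)
      have "p ^ 2 ^ 0 \<in> CM" unfolding CM_eq using B0 by blast
      then show "{2, 5} \<subseteq> CM" using two \<open>p = 5\<close> by simp
    qed simp
    ultimately have "weight {2, 5} * weight {9} < weight CM * weight CN"
      by (intro mult_le_less_imp_less) (auto simp: weight_def)
    then show False using weight_mult by simp
  qed
  then show ?thesis using prod_components [OF N_pos] by simp
qed

text \<open>
  Components that are 1 modulo 4 have the form \<open>2 p\<^sup>t - 1\<close> with distinct exponents \<open>t\<close>, so their total
  weight is bounded by a geometric series; those that are 3 modulo 4 are primes dividing
  \<open>3 (p + 1)\<close>; the only possible even one is \<open>p - 1\<close>.
\<close>

definition "Q1 = {q \<in> CN. q mod 4 = 1}"
definition "Q3 = {q \<in> CN. q mod 4 = 3}"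

lemma Q1_subset: "Q1 \<subseteq> CN" and Q3_subset: "Q3 \<subseteq> CN"
  by (auto simp: Q1_def Q3_def)

lemma finite_Q [simp]: "finite Q1" "finite Q3"
  by (auto simp: Q1_def Q3_def)

lemma Q1E:
  assumes "q \<in> Q1"
  obtains t where "t \<ge> 1" "t \<le> b" "q + 1 = 2 * p ^ t"
  using assms component_1_mod_4 [of q thesis] unfolding Q1_def by blast

lemma odd_component_cases: "q \<in> CN \<Longrightarrow> odd q \<Longrightarrow> q \<in> Q1 \<or> q \<in> Q3"
proof -
  assume "q \<in> CN" "odd q"
  moreover have "q mod 4 = 1 \<or> q mod 4 = 3" using \<open>odd q\<close> by presburger
  ultimately show ?thesis by (auto simp: Q1_def Q3_def)
qed

lemma weight_Q1:
  assumes "k > 0" "\<And>q t. q \<in> Q1 \<Longrightarrow> q + 1 = 2 * p ^ t \<Longrightarrow> t \<ge> k"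
  shows "weight Q1 \<le> 1 / (1 - (1 / real p) ^ k / (2 * (1 - 1 / real p)))"
proof (rule weight_le_geometric)
  fix q assume q: "q \<in> Q1"
  then obtain t where "q + 1 = 2 * p ^ t" by (rule Q1E)
  then show "\<exists>t\<ge>k. q + 1 = 2 * p ^ t" using assms(2) [OF q] by blast
qed (use assms p_ge_3 in auto)

lemma weight_Q1_default: "weight Q1 \<le> 1 / (1 - (1 / real p) / (2 * (1 - 1 / real p)))"
proof -
  have "t \<ge> 1" if "q \<in> Q1" "q + 1 = 2 * p ^ t" for q t
  proof (rule ccontr)
    assume "\<not> t \<ge> 1"
    then have "t = 0" by simp
    then have "q = 1" using that by simp
    then show False using that component_gt_1 [of q N] by (simp add: Q1_def)
  qed
  then show ?thesis using weight_Q1 [of 1] by simp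
qed

lemma weight_A_less:
  assumes "A \<subseteq> {k..}"
  shows "weight ((\<lambda>j. 2 ^ 2 ^ j) ` A) < 1 / (1 - (1 / 2) ^ 2 ^ k)"
  using weight_two_powers_less [of 2 A k] assms by simp

lemma weight_B_less:
  assumes "B \<subseteq> {k..}"
  shows "weight ((\<lambda>j. p ^ 2 ^ j) ` B) < 1 / (1 - (1 / real p) ^ 2 ^ k)"
  using weight_two_powers_less [of p B k] assms prime_p by simp

lemma A_ge_1: "even a \<Longrightarrow> A \<subseteq> {1..}"
  by (rule set_decode_even)

section \<open>Even \<open>a\<close> and odd \<open>N\<close>\<close>

text \<open>All components of \<open>N\<close> lie in \<open>Q1\<close>. The powers of 2, the powers
  of \<open>p\<close> and \<open>Q1\<close> have weights bounded by 4/3, 9/8 and 4/3, whose product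
  is exactly 2, and the first two bounds are strict.\<close>

lemma not_odd_N_0_notin_B:
  assumes "even a" "odd N" "0 \<notin> B"
  shows False
proof -
  have "Q3 = {}"
    using component_3_mod_4(2) assms by (auto simp: Q3_def)
  moreover have "odd q" if "q \<in> CN" for q
    using component_dvd [OF that N_pos] assms(2) by (metis dvd_trans)
  ultimately have "CN = Q1" using odd_component_cases Q1_subset by blast
  define x where "x = 1 / real p"
  have x: "0 < x" "x \<le> 1 / 3" using p_ge_3 by (auto simp: x_def field_simps)
  have "1 / (1 - x / (2 * (1 - x))) \<le> 4 / 3" using x by (simp add: field_simps)
  then have N: "weight CN \<le> 4 / 3" using weight_Q1_default \<open>CN = Q1\<close> by (simp add: x_def)
  have "B \<subseteq> {1..}" using assms(3) by (intro set_decode_even) simp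
  then have "weight ((\<lambda>j. p ^ 2 ^ j) ` B) < 1 / (1 - x ^ 2 ^ 1)"
    unfolding x_def by (rule weight_B_less)
  also have "\<dots> \<le> 9 / 8"
  proof -
    have "x * x \<le> 1 / 3 * (1 / 3)" using x by (intro mult_mono) auto
    then show ?thesis by (simp add: power2_eq_square field_simps)
  qed
  finally have B: "weight ((\<lambda>j. p ^ 2 ^ j) ` B) < 9 / 8" .
  have A: "weight ((\<lambda>j. 2 ^ 2 ^ j) ` A) < 4 / 3"
    using weight_A_less [OF A_ge_1 [OF assms(1)]] by (simp add: power2_eq_square)
  have "weight CM < 4 / 3 * (9 / 8)"
    unfolding weight_CM using A B weight_ge_1 [of "(\<lambda>j. p ^ 2 ^ j) ` B"]
      weight_ge_1 [of "(\<lambda>j. 2 ^ 2 ^ j) ` A"] by (intro mult_strict_mono) auto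
  then have "weight CM * weight CN < 4 / 3 * (9 / 8) * (4 / 3)"
    using N weight_ge_1 [of CM] weight_ge_1 [of CN] by (intro mult_less_le_imp_less) auto
  then show False using weight_mult by simp
qed

text \<open>
  Here weights do not suffice. The hypotheses force \<open>b = 1\<close>, so exactly one component is 1 modulo 4,
  namely \<open>2 p - 1\<close>; it must absorb every Fermat number dividing \<open>N\<close>, hence equals one of them, and
  then \<open>p\<close> is divisible by 3.
\<close>

lemma not_odd_N_0_in_B:
  assumes "even a" "odd N" "0 \<in> B"
  shows False
proof -
  \<comment> \<open>A second digit would supply a second even factor of \<open>2 * N\<close>, making
    \<open>N\<close> even.\<close>
  have "B = {0}"
  proof (rule ccontr)
    assume "B \<noteq> {0}"
    then obtain j where j: "j \<in> B" "j \<noteq> 0" using assms(3) by blast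
    have "(\<Prod>j\<in>{0, j}. 1 + p ^ 2 ^ j) dvd (\<Prod>j\<in>B. 1 + p ^ 2 ^ j)"
      using j assms(3) by (intro prod_dvd_prod_subset) auto
    then have "(1 + p) * (1 + p ^ 2 ^ j) dvd 2 * N"
      unfolding two_N_eq using j by (simp add: dvd_mult)
    moreover have "2 * 2 dvd (1 + p) * (1 + p ^ 2 ^ j)" using odd_p by (intro mult_dvd_mono) auto
    ultimately have "2 * 2 dvd 2 * N" by (rule dvd_trans [rotated])
    then show False using assms(2) by simp
  qed
  then have "b = 1" using set_decode_inverse [of b] by (simp add: set_encode_def)
  have p4: "p mod 4 = 1"
  proof (rule ccontr)
    assume "p mod 4 \<noteq> 1"
    then have "2 * 2 dvd 1 + p" using odd_p by presburger
    moreover have "1 + p dvd 2 * N" using p_power_dvd_two_N [OF assms(3)] by simp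
    ultimately have "2 * 2 dvd 2 * N" by (rule dvd_trans)
    then show False using assms(2) by simp
  qed
  have Q1_unique: "q + 1 = 2 * p" if q: "q \<in> Q1" for q
  proof -
    obtain t where "t \<ge> 1" "t \<le> b" "q + 1 = 2 * p ^ t"
      using q by (rule Q1E)
    with \<open>b = 1\<close> show ?thesis by (cases "t = 1") auto
  qed
  have comp: "\<exists>k. r ^ 2 ^ k \<in> Q1" if r: "prime r" "r mod 4 = 1" "r dvd N" for r
  proof -
    obtain k where "r ^ 2 ^ k \<in> CN" using prime_dvd_imp_component r N_pos by blast
    then show ?thesis using one_mod_4_power [OF r(2)] by (auto simp: Q1_def)
  qed
  \<comment> \<open>Each prime factor of a Fermat number dividing \<open>N\<close> has a power in
    \<open>Q1\<close>. Since \<open>2 * p - 1\<close> is the only possible element there, all these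
    primes coincide.\<close>
  have fermat_prime: "\<exists>k. r ^ 2 ^ k \<in> Q1" "r mod 4 = 1"
    if r: "prime r" "r dvd 1 + 2 ^ 2 ^ j" "j \<in> A" for r j
  proof -
    have "r dvd N" using r fermat_dvd_N dvd_trans by blast
    then have "odd r" using assms(2) by (metis dvd_trans)
    have "j > 0" using r(3) A_ge_1 [OF assms(1)] by auto
    then show "r mod 4 = 1" using r \<open>odd r\<close> prime_dvd_two_power_plus_1 by blast
    with \<open>r dvd N\<close> r show "\<exists>k. r ^ 2 ^ k \<in> Q1" using comp by blast
  qed
  obtain j where j: "j \<in> A" using A_nonempty by blast
  define F where "F = (1 + 2 ^ 2 ^ j :: nat)"
  have "F \<noteq> 1" by (simp add: F_def)
  then obtain r where r: "prime r" "r dvd F" using prime_factor_nat by blast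
  then obtain k where k: "r ^ 2 ^ k \<in> Q1" and r4: "r mod 4 = 1" using fermat_prime j F_def by blast
  define q where "q = r ^ 2 ^ k"
  have q: "q \<in> Q1" "q + 1 = 2 * p" using k Q1_unique by (auto simp: q_def)
  have r_unique: "r' = r" if "prime r'" "r' ^ 2 ^ k' \<in> Q1" for r' k'
  proof -
    have "r' ^ 2 ^ k' = r ^ 2 ^ k" using Q1_unique [OF that(2)] Q1_unique [OF k] by simp
    then show ?thesis using prime_power_two_power_eq_iff that(1) r(1) by blast
  qed
  \<comment> \<open>A second Fermat number would share the prime factor \<open>r\<close> with the
    first.\<close>
  have "A = {j}"
  proof (rule ccontr)
    assume "A \<noteq> {j}"
    then obtain i where i: "i \<in> A" "i \<noteq> j" using j by blast
    have "(1 + 2 ^ 2 ^ i :: nat) \<noteq> 1" by simp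
    then obtain r' :: nat where r': "prime r'" "r' dvd 1 + 2 ^ 2 ^ i" using prime_factor_nat by blast
    then have "r' = r" using fermat_prime i r_unique by blast
    then show False using fermat_number_common_prime r r' i(2) F_def by blast
  qed
  then have two_N: "2 * N = F * (1 + p)" using two_N_eq \<open>B = {0}\<close> by (simp add: F_def)
  define X where "X = \<Prod>(CN - {q})"
  have N: "N = q * X"
    using prod_components [OF N_pos] q(1) Q1_subset prod.remove [of CN q "\<lambda>x. x"]
    by (auto simp: X_def)
  \<comment> \<open>The only prime factor of \<open>F\<close> is \<open>r\<close>, and a second
    component that is a power of \<open>r\<close> would be a second element of
    \<open>Q1\<close>.\<close>
  have "coprime F X"
  proof (rule ccontr)
    assume "\<not> coprime F X"
    then have "gcd F X \<noteq> 1" by (simp add: coprime_iff_gcd_eq_1)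
    then obtain s where s: "prime s" "s dvd F" "s dvd X" using prime_factor_nat by (metis gcd_greatest_iff)
    then have "s = r" using fermat_prime j r_unique F_def by blast
    then obtain q' where q': "q' \<in> CN" "q' \<noteq> q" "r dvd q'"
      using s(1,3) unfolding X_def by (auto simp: prime_dvd_prod_iff)
    then obtain s' k' where s': "prime s'" "q' = s' ^ 2 ^ k'" by (blast elim: componentE)
    then have "r dvd s'" using q'(3) r(1) prime_dvd_power by blast
    then have "s' = r" using r(1) s'(1) primes_dvd_imp_eq by blast
    then have "q' \<in> Q1" using s' q' one_mod_4_power [OF r4] by (simp add: Q1_def)
    then have "q' + 1 = q + 1" using Q1_unique q(2) by simp
    then show False using q'(2) by simp
  qed
  moreover have "F dvd q * X" using fermat_dvd_N [OF j] N F_def by simp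
  ultimately have Fq: "F dvd q" using coprime_dvd_mult_left_iff by blast
  \<comment> \<open>As \<open>2 * (1 + p) - q = 3\<close>, a common prime factor would be 3, while
    \<open>r\<close> is 1 modulo 4.\<close>
  have "coprime q (1 + p)"
  proof -
    have "\<not> r dvd 1 + p"
    proof
      assume "r dvd 1 + p"
      moreover have "r dvd q" by (simp add: q_def dvd_power)
      ultimately have "r dvd 2 * (1 + p) - q" by (intro dvd_diff_nat dvd_mult)
      moreover have "2 * (1 + p) - q = 3" using q(2) by simp
      ultimately have "r = 3" using r(1) primes_dvd_imp_eq [of r 3] by simp
      then show False using r4 by simp
    qed
    then show ?thesis unfolding q_def using r(1) by (simp add: prime_imp_coprime)
  qed
  moreover have "q dvd F * (1 + p)" using N two_N by (metis dvd_mult dvd_triv_left)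
  ultimately have "q dvd F" using coprime_dvd_mult_left_iff by blast
  with Fq have "q = F" by (simp add: dvd_antisym)
  then have "2 * p = 2 ^ 2 ^ j + 2" using q(2) by (simp add: F_def)
  moreover have "(2::nat) ^ 2 ^ j mod 3 = 1"
    using j A_ge_1 [OF assms(1)] by (intro two_power_two_power_mod_3) auto
  ultimately have "3 dvd p" by presburger
  then have "p = 3" using prime_p primes_dvd_imp_eq [of 3 p] by simp
  with p4 show False by simp
qed

section \<open>Even \<open>a\<close> and even \<open>N\<close>: \<open>p\<close> is a Fermat
  prime\<close>

lemma even_N_components:
  assumes "even N"
  obtains i where "p = 1 + 2 ^ 2 ^ i" "CN = insert (p - 1) (Q1 \<union> Q3)"
    "weight CN = (1 + 1 / (real p - 1)) * (weight Q1 * weight Q3)"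
proof -
  obtain i where i: "2 ^ 2 ^ i \<in> CN"
    using prime_dvd_imp_component [OF two_is_prime_nat] assms N_pos by blast
  have p: "p = 1 + 2 ^ 2 ^ i" using component_even [OF i] by simp
  have CN: "CN = insert (p - 1) (Q1 \<union> Q3)"
  proof
    show "CN \<subseteq> insert (p - 1) (Q1 \<union> Q3)"
      using odd_component_cases component_even by fastforce
    show "insert (p - 1) (Q1 \<union> Q3) \<subseteq> CN"
      using i p Q1_subset Q3_subset by auto
  qed
  have "even (p - 1)" using odd_p by simp
  moreover have "odd q" if "q \<in> Q1 \<union> Q3" for q
  proof -
    have "q mod 4 = 1 \<or> q mod 4 = 3" using that by (auto simp: Q1_def Q3_def)
    then show ?thesis by presburger
  qed
  ultimately have "p - 1 \<notin> Q1 \<union> Q3" by blast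
  moreover have "Q1 \<inter> Q3 = {}" by (auto simp: Q1_def Q3_def)
  moreover have "real (p - 1) = real p - 1" using p by simp
  ultimately have "weight CN = (1 + 1 / (real p - 1)) * (weight Q1 * weight Q3)"
    unfolding CN by (simp add: weight_Un_disjoint)
  with that p CN show ?thesis by blast
qed

text \<open>Collects the five bounds of each case: for the powers of 2 and of \<open>p\<close> in
  \<open>M\<close>, for the even component of \<open>N\<close>, and for the two odd residue
  classes.\<close>

lemma weight_contradiction:
  assumes "weight ((\<lambda>j. 2 ^ 2 ^ j) ` A) \<le> u" "weight ((\<lambda>j. p ^ 2 ^ j) ` B) \<le> v"
    and "weight CN = w * (weight Q1 * weight Q3)" "0 \<le> w" "w \<le> w'"
    and "weight Q1 \<le> y" "weight Q3 \<le> z"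
    and "u * v * (w' * (y * z)) < 2"
  shows False
proof -
  have nn: "0 \<le> weight S" for S using weight_ge_1 [of S] by simp
  have "weight CM * weight CN \<le> (u * v) * (w' * (y * z))"
    unfolding weight_CM assms(3)
    using assms(1,2,4-7) nn order_trans [OF nn] by (intro mult_mono mult_nonneg_nonneg) auto
  then show False using weight_mult assms(8) by simp
qed

text \<open>Combinations of small components with weight 2 or more exclude digit 0 of
  \<open>B\<close> and digit 1 of \<open>A\<close> and \<open>B\<close>. The remaining bounds
  multiply to 16/15 * 81/80 * 3/2 * 12/11 < 2.\<close>

lemma not_even_N_p_3:
  assumes "even a" "p = 3" and CN: "CN = insert (p - 1) (Q1 \<union> Q3)"
    and wCN: "weight CN = (1 + 1 / (real p - 1)) * (weight Q1 * weight Q3)"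
  shows False
proof -
  have two: "2 \<in> CN" using CN assms(2) by simp
  obtain j0 where "j0 \<in> A" using A_nonempty by blast
  then have j0: "2 ^ 2 ^ j0 \<in> CM" unfolding CM_eq by blast
  have ne: "2 ^ 2 ^ j0 \<noteq> (m::nat)" if "odd m" for m using that by auto
  have B0: "0 \<notin> B"
  proof
    assume "0 \<in> B"
    then have "p ^ 2 ^ 0 \<in> CM" unfolding CM_eq by blast
    then have "{3} \<subset> CM" using j0 ne [of 3] assms(2) by auto
    then have "weight {3} * weight {2} < 2" using two by (intro weight_mult_less) auto
    then show False by simp
  qed
  then have "Q3 = {}" using component_3_mod_4(2) assms(1) by (auto simp: Q3_def)
  \<comment> \<open>The component that is a power of 5 satisfies
    \<open>5 ^ 2 ^ k + 1 = 2 * 3 ^ t\<close>. For \<open>k > 0\<close> the left side is a square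
    plus 1, which 3 cannot divide.\<close>
  have five: "5 \<in> CN" if dvd: "5 dvd N"
  proof -
    obtain k where k: "5 ^ 2 ^ k \<in> CN" using dvd prime_dvd_imp_component [of 5 N] N_pos by auto
    have "(5::nat) ^ 2 ^ k mod 4 = 1" by (rule one_mod_4_power) simp
    then obtain t where t: "t \<ge> 1" "5 ^ 2 ^ k + 1 = 2 * p ^ t" using component_1_mod_4 [OF k] by blast
    then have "3 dvd (5::nat) ^ 2 ^ k + 1" using assms(2) by (simp add: dvd_power)
    then have "k = 0"
      using prime_dvd_two_power_plus_1 [of 3 5 k] by (cases "k = 0") auto
    then show ?thesis using k by simp
  qed
  have A1: "1 \<notin> A"
  proof
    assume 1: "1 \<in> A"
    have "5 \<in> CN" using fermat_dvd_N [OF 1] five by simp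
    moreover have "2 ^ 2 ^ 1 \<in> CM" using 1 unfolding CM_eq by blast
    ultimately have "weight {4} * weight {2, 5} \<le> 2" using two by (intro weight_mult_le) auto
    then show False by simp
  qed
  have B1: "1 \<notin> B"
  proof
    assume 1: "1 \<in> B"
    have "10 dvd 2 * N" using p_power_dvd_two_N [OF 1] assms(2) by simp
    then have "5 dvd N" by presburger
    then have "5 \<in> CN" by (rule five)
    moreover have "p ^ 2 ^ 1 \<in> CM" using 1 unfolding CM_eq by blast
    then have "{9} \<subset> CM" using j0 ne [of 9] assms(2) by auto
    ultimately have "weight {9} * weight {2, 5} < 2" using two by (intro weight_mult_less) auto
    then show False by simp
  qed
  have ge2: "S \<subseteq> {2..}" if "S \<subseteq> {1..}" "1 \<notin> S" for S :: "nat set"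
  proof
    fix j assume "j \<in> S"
    then have "j \<ge> 1" "j \<noteq> 1" using that by auto
    then show "j \<in> {2..}" by simp
  qed
  have A2: "A \<subseteq> {2..}" using A_ge_1 [OF assms(1)] A1 by (rule ge2)
  have B2: "B \<subseteq> {2..}" using B0 B1 by (intro ge2 set_decode_even) simp_all
  \<comment> \<open>Among Fermat numbers 5 divides only the one with index 1, and for
    \<open>j \<ge> 2\<close> the number \<open>3 ^ 2 ^ j\<close> is a power of 81, hence 1 modulo
    5.\<close>
  have N5: "\<not> 5 dvd N"
  proof
    assume "5 dvd N"
    then have "prime (5::nat)" "5 dvd 2 * N" by simp_all
    then show False
    proof (cases rule: prime_dvd_two_N_cases)
      case (1 j)
      moreover have "(5::nat) dvd 1 + 2 ^ 2 ^ 1" by simp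
      ultimately have "j = 1" using fermat_number_common_prime [of 5 j 1] by simp
      then show False using 1 A1 by simp
    next
      case (2 j)
      have "j = 2 + (j - 2)" using 2(1) B2 by auto
      then have "(2::nat) ^ j = 2 ^ 2 * 2 ^ (j - 2)" by (metis power_add)
      then have "(2::nat) ^ j = 4 * 2 ^ (j - 2)" by simp
      then have "p ^ 2 ^ j mod 5 = (81 ^ 2 ^ (j - 2)) mod 5" using assms(2) by (simp add: power_mult)
      also have "\<dots> = (81 mod 5) ^ 2 ^ (j - 2) mod 5" by (simp only: power_mod)
      finally have "p ^ 2 ^ j mod 5 = 1" by simp
      then show False using 2(2) by presburger
    qed
  qed
  \<comment> \<open>Exponent 1 would give the excluded component 5. Starting the series at 2 lowers
    the bound for \<open>Q1\<close> from 4/3 to 12/11.\<close>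
  have "t \<ge> 2" if "q \<in> Q1" "q + 1 = 2 * p ^ t" for q t
  proof (rule ccontr)
    assume "\<not> t \<ge> 2"
    then consider "t = 0" | "t = 1" by linarith
    then show False
    proof cases
      case 1
      then show False using that component_gt_1 [of q N] Q1_subset by auto
    next
      case 2
      then have "q = 5" using that assms(2) by simp
      then show False using that N5 component_dvd N_pos Q1_subset by blast
    qed
  qed
  then have "weight Q1 \<le> 1 / (1 - (1 / real p) ^ 2 / (2 * (1 - 1 / real p)))"
    by (intro weight_Q1) auto
  then have Q1: "weight Q1 \<le> 12 / 11" using assms(2) by (simp add: power2_eq_square)
  show False
  proof (rule weight_contradiction [OF _ _ wCN _ order_refl Q1])
    show "weight ((\<lambda>j. 2 ^ 2 ^ j) ` A) \<le> 16 / 15"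
      using weight_A_less [OF A2] by (simp add: power_divide)
    show "weight ((\<lambda>j. p ^ 2 ^ j) ` B) \<le> 81 / 80"
      using weight_B_less [OF B2] assms(2) by (simp add: power_divide)
    show "weight Q3 \<le> 1" using \<open>Q3 = {}\<close> by simp
  qed (use assms(2) in auto)
qed

text \<open>Otherwise the Fermat number \<open>p\<close> would itself divide \<open>N\<close>;
  \<open>i > 0\<close> makes \<open>p\<close> equal to 1 modulo 4.\<close>

lemma fermat_index_notin_A:
  assumes "p = 1 + 2 ^ 2 ^ i" "i > 0"
  shows "i \<notin> A"
proof
  assume "i \<in> A"
  then have "p dvd N" using fermat_dvd_N assms(1) by simp
  moreover have "(2::nat) ^ 2 ^ i mod 4 = 0"
  proof -
    have "(2::nat) ^ 2 dvd 2 ^ 2 ^ i" using assms(2) by (intro le_imp_power_dvd) (simp add: self_le_power)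
    then show ?thesis by simp
  qed
  then have "p mod 4 = 1" using assms(1) by presburger
  ultimately show False using p_not_dvd_N by blast
qed

text \<open>An element of \<open>Q3\<close> could only be 3, which together with 4 in
  \<open>N\<close> and 5 in \<open>M\<close> has weight 2. With index 1 missing from
  \<open>A\<close>, the bounds multiply to 16/15 * 5/4 * 5/4 * 8/7 < 2.\<close>

lemma not_even_N_p_5:
  assumes "even a" "p = 5" and CN: "CN = insert (p - 1) (Q1 \<union> Q3)"
    and wCN: "weight CN = (1 + 1 / (real p - 1)) * (weight Q1 * weight Q3)"
  shows False
proof -
  have four: "4 \<in> CN" using CN assms(2) by simp
  obtain j0 where "j0 \<in> A" using A_nonempty by blast
  then have j0: "2 ^ 2 ^ j0 \<in> CM" unfolding CM_eq by blast
  have ne: "2 ^ 2 ^ j0 \<noteq> (5::nat)" by (metis even_power even_numeral odd_numeral zero_less_numeral zero_less_power)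
  have "Q3 = {}"
  proof (rule ccontr)
    assume "Q3 \<noteq> {}"
    then obtain q where q: "q \<in> CN" "q mod 4 = 3" by (auto simp: Q3_def)
    have "q dvd 1 + p" "0 \<in> B" using component_3_mod_4(2) [OF q] assms(1) by auto
    then have "q dvd 2 * 3" using assms(2) by simp
    then have "q dvd 2 \<or> q dvd 3" using component_3_mod_4(1) [OF q] prime_dvd_mult_iff by blast
    then have "q = 2 \<or> q = 3"
      using component_3_mod_4(1) [OF q] primes_dvd_imp_eq [of q 2] primes_dvd_imp_eq [of q 3] by auto
    then have "3 \<in> CN" using q by auto
    have "p ^ 2 ^ 0 \<in> CM" using \<open>0 \<in> B\<close> unfolding CM_eq by blast
    then have "{5} \<subset> CM" using j0 ne assms(2) by auto
    then have "weight {5} * weight {3, 4} < 2" using four \<open>3 \<in> CN\<close> by (intro weight_mult_less) auto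
    then show False by simp
  qed
  have A2: "A \<subseteq> {2..}"
  proof
    fix j assume j: "j \<in> A"
    then have "j \<ge> 1" using A_ge_1 [OF assms(1)] by auto
    moreover have "j \<noteq> 1" using j fermat_index_notin_A [of 1] assms(2) by auto
    ultimately show "j \<in> {2..}" by simp
  qed
  have Q1: "weight Q1 \<le> 8 / 7" using weight_Q1_default assms(2) by simp
  show False
  proof (rule weight_contradiction [OF _ _ wCN _ order_refl Q1])
    show "weight ((\<lambda>j. 2 ^ 2 ^ j) ` A) \<le> 16 / 15"
      using weight_A_less [OF A2] by (simp add: power_divide)
    show "weight ((\<lambda>j. p ^ 2 ^ j) ` B) \<le> 5 / 4"
      using weight_B_less [of 0] assms(2) by simp
    show "weight Q3 \<le> 1" using \<open>Q3 = {}\<close> by simp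
  qed (use assms(2) in auto)
qed

text \<open>Since \<open>q\<close> divides \<open>(1 + p) / 2\<close>, it is too small for
  \<open>1 + q\<close> to contain a factor \<open>p\<close>, so \<open>1 + q = 2 ^ s\<close>. With
  \<open>s\<close> even this is a power of 4, whence 3 divides \<open>q\<close>.\<close>

lemma Q3_subset_3:
  assumes "even a" "p = 1 + 2 ^ 2 ^ i" "i > 0"
  shows "Q3 \<subseteq> {3}"
proof
  fix q assume "q \<in> Q3"
  then have q: "q \<in> CN" "q mod 4 = 3" by (auto simp: Q3_def)
  have "prime q" using component_3_mod_4(1) [OF q] .
  have "odd q" using q(2) by presburger
  define c where "c = (2::nat) ^ i - 1"
  have c: "(2::nat) ^ i = Suc c" "odd c" using assms(3) by (auto simp: c_def)
  have "q dvd 1 + p" using component_3_mod_4(2) [OF q] assms(1) by auto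
  moreover have "1 + p = 2 * (1 + 2 ^ c)" using assms(2) c by simp
  ultimately have qd: "q dvd 1 + 2 ^ c"
    using \<open>odd q\<close> by (metis coprime_commute coprime_dvd_mult_right_iff coprime_left_2_iff_odd)
  then have "q \<le> 1 + 2 ^ c" by (intro dvd_imp_le) auto
  moreover have "(2::nat) ^ c > 1" using c(2) by (intro one_less_power) (auto intro: odd_pos)
  ultimately have "1 + q < p" using assms(2) c by simp
  obtain s t where st: "1 + q = 2 ^ s * p ^ t" using component_decomp [OF q(1)] by blast
  have "t = 0"
  proof (rule ccontr)
    assume "t \<noteq> 0"
    then have "p \<le> p ^ t" using p_ge_3 by (simp add: self_le_power)
    also have "\<dots> \<le> 1 + q" using st by simp
    finally show False using \<open>1 + q < p\<close> by simp
  qed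
  with st have s: "1 + q = 2 ^ s" by simp
  have "even s" \<comment> \<open>compare the two values of \<open>2 ^ (s * c)\<close> modulo \<open>q\<close>\<close>
  proof (rule ccontr)
    assume "odd s"
    have "int (1 + q) = 2 ^ s" using s by simp
    then have "[2 ^ s = 1] (mod int q)" by (simp add: cong_iff_dvd_diff flip: \<open>int (1 + q) = 2 ^ s\<close>)
    then have "[(2 ^ s) ^ c = 1 ^ c] (mod int q)" by (rule cong_pow)
    moreover have "int q dvd int (1 + 2 ^ c)" using qd int_dvd_int_iff by blast
    then have "[2 ^ c = - 1] (mod int q)" by (simp add: cong_iff_dvd_diff add.commute)
    then have "[(2 ^ c) ^ s = (- 1) ^ s] (mod int q)" by (rule cong_pow)
    moreover have "((2::int) ^ s) ^ c = (2 ^ c) ^ s" by (metis power_mult mult.commute)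
    ultimately have "[1 = - 1] (mod int q)" using \<open>odd s\<close> by (simp add: cong_def)
    then have "int q dvd 2" by (simp add: cong_iff_dvd_diff)
    then have "q \<le> 2" by (auto dest: zdvd_imp_le)
    with q(2) show False using prime_ge_2_nat [OF \<open>prime q\<close>] by simp
  qed
  then obtain u where "s = 2 * u" by (rule evenE)
  then have "1 + q = 4 ^ u" using s by (simp add: power_mult)
  moreover have "(4::nat) ^ u mod 3 = (4 mod 3) ^ u mod 3" by (simp only: power_mod)
  ultimately have "(1 + q) mod 3 = 1" by simp
  then have "3 dvd q" by presburger
  then have "q = 3" using \<open>prime q\<close> primes_dvd_imp_eq [of 3 q] by simp
  then show "q \<in> {3}" by simp
qed

lemma not_even_N_p_ge_17:
  assumes "even a" "p = 1 + 2 ^ 2 ^ i" "i \<ge> 2"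
    and wCN: "weight CN = (1 + 1 / (real p - 1)) * (weight Q1 * weight Q3)"
  shows False
proof -
  have "weight Q3 \<le> weight {3}" using Q3_subset_3 assms by (intro weight_mono) auto
  then have Q3: "weight Q3 \<le> 4 / 3" by simp
  show False
  proof (cases "i = 2")
    case True
    then have p: "p = 17" using assms(2) by simp
    \<comment> \<open>For \<open>p = 17\<close> the bound 4/3 for the powers of 2 would be too weak.
      Index 2 is absent because \<open>p = 1 + 2 ^ 2 ^ 2\<close>, which improves it to 5/4 * 256/255
      = 64/51.\<close>
    have A3: "A - {1} \<subseteq> {3..}"
    proof
      fix j assume j: "j \<in> A - {1}"
      then have "j \<ge> 1" using A_ge_1 [OF assms(1)] by auto
      moreover have "j \<noteq> 1" "j \<noteq> 2" using j fermat_index_notin_A [of 2] p by auto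
      ultimately show "j \<in> {3..}" by simp
    qed
    let ?f = "\<lambda>j. (2::nat) ^ 2 ^ j"
    have less: "weight (?f ` (A - {1})) \<le> 256 / 255"
      using weight_two_powers_less [OF two_is_prime_nat _ A3] by (simp add: power_divide)
    have notin: "4 \<notin> ?f ` (A - {1})"
    proof
      assume "4 \<in> ?f ` (A - {1})"
      then obtain j where j: "j \<noteq> 1" "4 = ?f j" by blast
      have "(2::nat) ^ 2 ^ 1 = 4" by simp
      also have "\<dots> = 2 ^ 2 ^ j" using j(2) .
      finally have "j = 1"
        using prime_power_two_power_eq_iff [OF two_is_prime_nat two_is_prime_nat] by metis
      with j(1) show False by simp
    qed
    have "weight (?f ` A) \<le> weight (insert 4 (?f ` (A - {1})))"
      by (rule weight_mono) auto
    also have "\<dots> = (1 + 1 / 4) * weight (?f ` (A - {1}))" using notin by simp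
    also have "\<dots> \<le> 64 / 51" using less by simp
    finally have A: "weight (?f ` A) \<le> 64 / 51" .
    have Q1: "weight Q1 \<le> 32 / 31" using weight_Q1_default p by simp
    show False
    proof (rule weight_contradiction [OF A _ wCN _ order_refl Q1 Q3])
      show "weight ((\<lambda>j. p ^ 2 ^ j) ` B) \<le> 17 / 16"
        using weight_B_less [of 0] p by simp
    qed (use p in auto)
  next
    case False
    then have "(2::nat) ^ 3 \<le> 2 ^ i" using assms(3) by (intro power_increasing) auto
    then have "(2::nat) ^ 8 \<le> 2 ^ 2 ^ i" by (intro power_increasing) auto
    then have p: "p \<ge> 257" using assms(2) by simp
    define x where "x = 1 / real p"
    have x: "0 < x" "x \<le> 1 / 257" using p by (auto simp: x_def field_simps)
    have "1 / (1 - x / (2 * (1 - x))) \<le> 512 / 511" using x by (simp add: field_simps)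
    then have Q1: "weight Q1 \<le> 512 / 511" using weight_Q1_default by (simp add: x_def)
    have "1 / (1 - x) \<le> 257 / 256" using x by (simp add: field_simps)
    then have B: "weight ((\<lambda>j. p ^ 2 ^ j) ` B) \<le> 257 / 256"
      using weight_B_less [of 0] by (simp add: x_def)
    have A: "weight ((\<lambda>j. 2 ^ 2 ^ j) ` A) \<le> 4 / 3"
      using weight_A_less [OF A_ge_1 [OF assms(1)]] by (simp add: power2_eq_square)
    have w: "1 + 1 / (real p - 1) \<le> 257 / 256" using p by (simp add: field_simps)
    show False
      by (rule weight_contradiction [OF A B wCN _ w Q1 Q3]) (use p in auto)
  qed
qed

lemma odd_a: "odd a"
proof
  assume a: "even a"
  show False
  proof (cases "even N")
    case False
    then show False using a not_odd_N_0_in_B not_odd_N_0_notin_B by blast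
  next
    case True
    then obtain i where i: "p = 1 + 2 ^ 2 ^ i" "CN = insert (p - 1) (Q1 \<union> Q3)"
      "weight CN = (1 + 1 / (real p - 1)) * (weight Q1 * weight Q3)"
      by (rule even_N_components)
    consider "i = 0" | "i = 1" | "i \<ge> 2" by linarith
    then show False
      using i a not_even_N_p_3 not_even_N_p_5 not_even_N_p_ge_17 by cases auto
  qed
qed

end

section \<open>Odd images and the final case distinction\<close>

text \<open>All components of \<open>N\<close> are even, so \<open>N\<close> is a power of 2. A
  component \<open>2 ^ 2 ^ i\<close> with \<open>i > 0\<close> would yield a prime factor
  \<open>r\<close> of \<open>M\<close> that is 1 modulo 4, and then
  \<open>(1 + r ^ 2 ^ k) / 2\<close> would be an odd divisor of \<open>N\<close> greater than
  1.\<close>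

lemma superperfect_odd_sigma:
  assumes "N > 0" "sigma_inf (sigma_inf N) = 2 * N" "odd (sigma_inf N)"
  shows "N = 2"
proof -
  define M where "M = sigma_inf N"
  have "M > 0" using assms(3) by (auto simp: M_def intro: odd_pos)
  have even_comp: "even q" if "q \<in> infinitary_components N" for q
    using Suc_component_dvd [OF that assms(1)] assms(3) by (metis dvd_trans even_Suc plus_1_eq_Suc)
  have only_two: "s = 2" if s: "prime s" "s dvd N" for s
  proof -
    obtain k where "s ^ 2 ^ k \<in> infinitary_components N" using prime_dvd_imp_component s assms(1) by blast
    then have "even s" using even_comp by fastforce
    then show ?thesis using s(1) by (metis primes_dvd_imp_eq two_is_prime_nat)
  qed
  have "q = 2" if q: "q \<in> infinitary_components N" for q
  proof -
    obtain s i where s: "prime s" "q = s ^ 2 ^ i" using q by (rule componentE)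
    then have "s dvd N" using component_dvd [OF q assms(1)] by (meson dvd_power dvd_trans zero_less_numeral zero_less_power)
    then have "s = 2" using only_two s(1) by blast
    have "i = 0"
    proof (rule ccontr)
      assume "i \<noteq> 0"
      have "(1 + 2 ^ 2 ^ i :: nat) \<noteq> 1" by simp
      then obtain r :: nat where r: "prime r" "r dvd 1 + 2 ^ 2 ^ i" using prime_factor_nat by blast
      then have "r dvd M"
        using Suc_component_dvd [OF q assms(1)] s(2) \<open>s = 2\<close> by (metis M_def dvd_trans)
      then have "odd r" using assms(3) M_def by (metis dvd_trans)
      then have r4: "r mod 4 = 1" using r \<open>i \<noteq> 0\<close> prime_dvd_two_power_plus_1 by blast
      obtain k where k: "r ^ 2 ^ k \<in> infinitary_components M"
        using prime_dvd_imp_component r(1) \<open>r dvd M\<close> \<open>M > 0\<close> by blast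
      define y where "y = (1 + r ^ 2 ^ k) div 2"
      have "r ^ 2 ^ k mod 4 = 1" using r4 by (rule one_mod_4_power)
      then have y: "2 * y = 1 + r ^ 2 ^ k" "odd y" unfolding y_def by presburger+
      have "y \<noteq> 1" using y(1) component_gt_1 [OF k] by linarith
      then obtain s' where s': "prime s'" "s' dvd y" using prime_factor_nat by blast
      have "2 * y dvd 2 * N" using Suc_component_dvd [OF k \<open>M > 0\<close>] assms(2) y(1) by (simp add: M_def)
      then have "y dvd N" by simp
      then have "s' = 2" using only_two s' dvd_trans by blast
      with s' y(2) show False by simp
    qed
    with s \<open>s = 2\<close> show ?thesis by simp
  qed
  then have sub: "infinitary_components N \<subseteq> {2}" by blast
  moreover have "infinitary_components N \<noteq> {}"
  proof
    assume "infinitary_components N = {}"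
    then have "N = 1" "sigma_inf N = 1"
      using prod_components [OF assms(1)] sigma_inf_eq_prod [OF assms(1)] by simp_all
    then show False using assms(2) by simp
  qed
  ultimately have "infinitary_components N = {2}" by blast
  then show ?thesis using prod_components [OF assms(1)] by simp
qed

theorem theorem1p2:
  fixes N :: nat
  assumes "N > 0"
    and "sigma_inf (sigma_inf N) = 2 * N"
    and "omega (sigma_inf N) \<le> 2"
  shows "N = 2 \<or> N = 9"
proof (cases "odd (sigma_inf N)")
  case True
  then show ?thesis using superperfect_odd_sigma assms by blast
next
  case False
  define M where "M = sigma_inf N"
  have "M > 0" unfolding M_def sigma_inf_eq_prod [OF assms(1)] by (rule prod_pos) simp
  have M: "(\<Prod>r\<in>prime_factors M. r ^ multiplicity r M) = M"
    using prod_prime_factors [of M] \<open>M > 0\<close> by simp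
  have two: "2 \<in> prime_factors M"
    using False \<open>M > 0\<close> by (auto simp: M_def prime_factors_dvd)
  have card: "card (prime_factors M - {2}) \<le> 1"
    using assms(3) two by (simp add: omega_def M_def)
  have "prime_factors M - {2} \<noteq> {}"
  proof
    assume "prime_factors M - {2} = {}"
    then have "prime_factors M = {2}" using two by blast
    \<comment> \<open>The factor \<open>3 ^ 0\<close> is a dummy that makes the description of
      components for two primes applicable to a power of 2.\<close>
    then have "M = 2 ^ multiplicity 2 M * 3 ^ 0" using M by simp
    then have C: "infinitary_components M = (\<lambda>j. 2 ^ 2 ^ j) ` set_decode (multiplicity 2 M)"
      using infinitary_components_two_primes [of 2 3 "multiplicity 2 M" 0] by simp
    have "odd (\<Prod>q\<in>infinitary_components M. 1 + q)"
      by (auto simp: C prime_dvd_prod_iff)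
    then have "odd (2 * N)" using assms(2) sigma_inf_eq_prod [OF \<open>M > 0\<close>] by (metis M_def)
    then show False by simp
  qed
  then have "card (prime_factors M - {2}) = 1" using card by (simp add: Suc_leI card_gt_0_iff le_antisym)
  then obtain p where p: "prime_factors M - {2} = {p}" by (auto simp: card_1_singleton_iff)
  then have pf: "prime_factors M = {2, p}" "p \<noteq> 2" using two by blast+
  have p_in: "p \<in> prime_factors M" using pf by simp
  define a b where "a = multiplicity 2 M" and "b = multiplicity p M"
  have "M = 2 ^ a * p ^ b" using M pf by (simp add: a_def b_def)
  moreover have "prime p" using p_in by (rule in_prime_factors_imp_prime)
  moreover have "odd p" using \<open>prime p\<close> pf(2) by (metis primes_dvd_imp_eq two_is_prime_nat)
  moreover have "a > 0" "b > 0" using two p_in by (simp_all add: prime_factors_multiplicity a_def b_def)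
  ultimately interpret superperfect_two_primes N p a b
    using assms by unfold_locales (simp_all add: M_def)
  show ?thesis using N_eq_9 odd_a by blast
qed

end
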